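(* Let $1<\alpha<2$ and $\beta=\alpha-1$. Let $u_0\in C^{\alpha^+}(\mathbb{R})$ satisfy (H1) $u_0$ is compactly supported and $u_0(x)\ge 0$; (H2) $u_0(0)=u_{0,x}(0)=0$; (H3) $u_0(x)=u_0(-x)$; and let $$u(x,t)\in C([0,T);C^{1+\beta^+}(\mathbb{R}))\cap C^1([0,T);C^{0^+}(\mathbb{R}))$$ be a solution of $$\partial_t u+\left(u\,\Lambda^{\alpha-1}Hu\right)_x=0,\qquad u(x,0)=u_0(x).$$ Then there exists a time $T<\infty$ such that $$\lim_{t\to T^-}\|u(\cdot,t)\|_{C^{\alpha^+}}=\infty .$$
   Context: The equation is posed on the real line $\mathbb{R}$, and the subscript $x$ denotes the derivative in $x$. For $s\ge 0$, $s^+$ denotes a number slightly larger than $s$, and $C^{s^+}$ is the corresponding Hölder space; since $1+\beta=\alpha$, the notations $C^{\alpha^+}$ and $C^{1+\beta^+}$ refer to the same kind of space. The Hilbert transform is $Hu(x)=\frac1\pi\int_{-\infty}^{\infty}\frac{u(y)}{x-y}\,dy$ (principal value), and $\Lambda^{s}$ is the operator with Fourier symbol $|\xi|^{s}$. For $1<\alpha<2$, with $\beta=\alpha-1\in(0,1)$, one has $\Lambda^{\alpha-1}Hu=\Lambda^{\beta}Hu=-\Lambda^{\beta-1}u_x$, where $$\Lambda^{\beta-1}f(x)=c_\beta\int_{\mathbb{R}}\frac{f(y)}{|x-y|^{\beta}}\,dy,\qquad c_\beta=\frac{\Gamma(\beta/2)}{\sqrt{\pi}\,2^{1-\beta}\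,\Gamma\left(\frac{1-\beta}{2}\right)}.$$
   Formalization: The formal theorem assumes u_0 is not identically zero and that the solution u can be continued in its class past any time at which its C^{α+} norm does not tend to infinity; with u_0=0, or with u restricted to a shorter time interval, the claim fails. *)

theory Defs
  imports "HOL-Analysis.Analysis"
begin

text \<open>
  For a non-integer order \<open>s > 0\<close>, the Hoelder space \<open>C\<^sup>s(\<real>)\<close> of
  functions with \<open>k = \<lfloor>s\<rfloor>\<close> bounded derivatives, the last of which is
  (globally) Hoelder continuous with exponent \<open>s - k\<close>. Only non-integer orders are used.
\<close>

definition holder_space :: "real \<Rightarrow> (real \<Rightarrow> real) set" where
  "holder_space s = {f.
     (\<forall>j<nat \<lfloor>s\<rfloor>. \<forall>x. (deriv ^^ j) f differentiable (at x)) \<and>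
     (\<forall>j\<le>nat \<lfloor>s\<rfloor>. bounded (range ((deriv ^^ j) f))) \<and>
     (\<exists>C. \<forall>x y. \<bar>(deriv ^^ nat \<lfloor>s\<rfloor>) f x - (deriv ^^ nat \<lfloor>s\<rfloor>) f y\<bar> \<le> C * \<bar>x - y\<bar> powr frac s)}"

text \<open>Meaningful on \<^const>\<open>holder_space\<close> only, where all suprema are finite.\<close>

definition holder_norm :: "real \<Rightarrow> (real \<Rightarrow> real) \<Rightarrow> real" where
  "holder_norm s f =
     (\<Sum>j\<le>nat \<lfloor>s\<rfloor>. SUP x. \<bar>(deriv ^^ j) f x\<bar>) +
     (SUP (x, y)\<in>{(x, y). x \<noteq> y}.
        \<bar>(deriv ^^ nat \<lfloor>s\<rfloor>) f x - (deriv ^^ nat \<lfloor>s\<rfloor>) f y\<bar> / \<bar>x - y\<bar> powr frac s)"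

text \<open>
  \<open>C([0,T); C\<^sup>s)\<close> and \<open>C\<^sup>1([0,T); C\<^sup>s)\<close>; the time derivative is the
  limit of the difference quotients in the norm of \<open>C\<^sup>s\<close>, one-sided at time 0.
  Functions of space and time take the time first: \<open>u t x\<close>.
\<close>

definition C0_holder :: "real \<Rightarrow> real \<Rightarrow> (real \<Rightarrow> real \<Rightarrow> real) \<Rightarrow> bool" where
  "C0_holder T s u \<longleftrightarrow>
     (\<forall>t\<in>{0..<T}. u t \<in> holder_space s \<and>
        ((\<lambda>\<tau>. holder_norm s (\<lambda>x. u \<tau> x - u t x)) \<longlongrightarrow> 0) (at t within {0..<T}))"

definition C1_holder :: "real \<Rightarrow> real \<Rightarrow> (real \<Rightarrow> real \<Rightarrow> real) \<Rightarrow> bool" where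
  "C1_holder T s u \<longleftrightarrow>
     C0_holder T s u \<and>
     (\<exists>u'. C0_holder T s u' \<and>
        (\<forall>t\<in>{0..<T}.
           ((\<lambda>\<tau>. holder_norm s (\<lambda>x. (u \<tau> x - u t x) / (\<tau> - t) - u' t x)) \<longlongrightarrow> 0)
             (at t within {0..<T})))"

definition riesz_const :: "real \<Rightarrow> real" where
  "riesz_const \<beta> =
     Gamma (\<beta> / 2) / (sqrt pi * 2 powr (1 - \<beta>) * Gamma ((1 - \<beta>) / 2))"

text \<open>
  The operator \<open>\<Lambda>\<close> to the power \<open>\<beta> - 1\<close>, for \<open>0 < \<beta> < 1\<close>.
  The Henstock-Kurzweil integral includes improper integrals over the line. Hence it exists for
  \<open>f = deriv u\<close> whenever \<open>u\<close> is bounded with bounded continuous derivative, although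
  the integrand need not be absolutely integrable at infinity; where it is absolutely integrable,
  this is the Lebesgue integral.
\<close>

definition riesz_potential :: "real \<Rightarrow> (real \<Rightarrow> real) \<Rightarrow> real \<Rightarrow> real" where
  "riesz_potential \<beta> f x =
     riesz_const \<beta> * integral UNIV (\<lambda>y. f y / \<bar>x - y\<bar> powr \<beta>)"

text \<open>
  \<open>\<Lambda>\<close> to the power \<open>\<alpha> - 1\<close> composed with the Hilbert transform, for
  \<open>1 < \<alpha> < 2\<close>. With \<open>\<beta> = \<alpha> - 1\<close> its Fourier symbol is
  \<open>- \<i> sgn \<xi> |\<xi>|\<^sup>\<beta>\<close>, that is, minus the symbol
  \<open>|\<xi>|\<close> to the power \<open>\<beta> - 1\<close> times \<open>\<i> \<xi>\<close>; this representation
  gives it a pointwise meaning on bounded, not necessarily decaying, Hoelder functions.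
\<close>

definition LambdaH :: "real \<Rightarrow> (real \<Rightarrow> real) \<Rightarrow> real \<Rightarrow> real" where
  "LambdaH \<alpha> u x = - riesz_potential (\<alpha> - 1) (deriv u) x"

definition solves :: "real \<Rightarrow> real \<Rightarrow> (real \<Rightarrow> real) \<Rightarrow> (real \<Rightarrow> real \<Rightarrow> real) \<Rightarrow> bool" where
  "solves \<alpha> T u\<^sub>0 u \<longleftrightarrow>
     u 0 = u\<^sub>0 \<and>
     (\<forall>t\<in>{0..<T}. \<forall>x. \<exists>u_t flux_x.
        ((\<lambda>\<tau>. u \<tau> x) has_real_derivative u_t) (at t within {0..<T}) \<and>
        ((\<lambda>y. u t y * LambdaH \<alpha> (u t) y) has_real_derivative flux_x) (at x) \<and>
        u_t + flux_x = 0)"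

text \<open>
  Solutions on \<open>[0,T)\<close> in \<open>C([0,T); C\<^sup>s) \<inter> C\<^sup>1([0,T); C\<^sup>\<delta>)\<close>.
\<close>

definition holder_solution ::
  "real \<Rightarrow> real \<Rightarrow> real \<Rightarrow> real \<Rightarrow> (real \<Rightarrow> real) \<Rightarrow> (real \<Rightarrow> real \<Rightarrow> real) \<Rightarrow> bool" where
  "holder_solution \<alpha> s \<delta> T u\<^sub>0 u \<longleftrightarrow>
     C0_holder T s u \<and> C1_holder T \<delta> u \<and> solves \<alpha> T u\<^sub>0 u"

end

theory Submission
  imports Defs
begin

text \<open>
  Non-negativity and the zero of the datum are transported by the characteristics
  \<open>X' = v(t, X)\<close> of the velocity \<open>v = LambdaH \<alpha> u\<close>, because along them \<open>u\<close> satisfies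
  \<open>\<bar>d/dt u(t, X)\<bar> \<le> L \<bar>u(t, X)\<bar>\<close>. Let \<open>X\<close> start at the origin, \<open>w(t, z) = u(t, X(t) + z)\<close>,
  and \<open>J(t) = \<integral> w(t, z) |z|\<^sup>-\<^sup>1\<^sup>-\<^sup>\<alpha> dz\<close>, which is finite since \<open>w\<close> vanishes at \<open>0\<close>
  together with its derivative. With \<open>a(z) = sgn z |z|\<^sup>-\<^sup>2\<^sup>-\<^sup>\<alpha>\<close> and \<open>k(s) = sgn s |s|\<^sup>-\<^sup>\<alpha>\<close>, the equation gives
  \<open>J' = c \<integral>\<integral> a(z) w(z) w(y) (k(y - z) - k(y)) dy dz\<close>, and symmetrizing in \<open>y, z\<close> the kernel
  becomes at least \<open>|z|\<^sup>-\<^sup>1\<^sup>-\<^sup>\<alpha> |y|\<^sup>-\<^sup>1\<^sup>-\<^sup>\<alpha>\<close>. Hence \<open>J' \<ge> c J\<^sup>2 / 2\<close>, which bounds the time of existence.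
  The term \<open>k(y)\<close>, the velocity at \<open>X\<close> itself, makes the inner integral \<open>O(z)\<close>; without it \<open>J'\<close> would
  not be finite.
\<close>

section \<open>Power weights and the symmetrized kernel\<close>

text \<open>The exponent of the weight is forced by homogeneity: for the weight |z|^(-p) the
  symmetrized kernel has degree -(p+1+\<alpha>), and only p = 1+\<alpha> makes this the degree of
  |z|^(-p) |y|^(-p), whose double integral is a square. The price is a strong singularity: with
  \<theta> = s-1 the profile is O(|z|^(1+\<theta>)), so the weighted profile is integrable at 0
  because \<theta> > \<alpha>-1; this is the use of the surplus \<epsilon> over the order \<alpha>.
  The same inequality makes the velocity Lipschitz in x. Its differentiability is never established,
  so the product rule for the flux is replaced by a bound. A bounded existence time becomes blow-up
  of the norm as follows: the supremum of all times up to which \<open>u\<close> is a solution is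
  again such a time, and there \<open>continued\<close> leaves only divergence of the norm.\<close>

lemma powr_tendsto_0_at_infinity:
  fixes e :: real assumes "e < 0"
  shows "((\<lambda>x::real. \<bar>x - c\<bar> powr e) \<longlongrightarrow> 0) at_infinity"
proof -
  have "filterlim (\<lambda>x::real. x - c) at_infinity at_infinity"
    using tendsto_add_filterlim_at_infinity'[OF filterlim_ident, of "\<lambda>_. -c" "-c"] by simp
  then have "filterlim (\<lambda>x::real. \<bar>x - c\<bar>) at_top at_infinity"
    using filterlim_at_infinity_imp_norm_at_top by fastforce
  then show ?thesis
    using tendsto_neg_powr[OF assms] by blast
qed

text \<open>Both integrations by parts on the line rest on this. The singular point \<open>c\<close>
  of a power weight costs only continuity of \<open>H\<close>, and the gauge integral allows
  \<open>h\<close> to be merely conditionally integrable at infinity.\<close>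

lemma has_integral_derivative_vanishing_at_infinity:
  fixes H h :: "real \<Rightarrow> real"
  assumes cont: "continuous_on UNIV H"
    and der: "\<And>x. x \<noteq> c \<Longrightarrow> (H has_real_derivative h x) (at x)"
    and lim: "(H \<longlongrightarrow> 0) at_infinity"
  shows "(h has_integral 0) UNIV"
  unfolding has_integral_alt'
proof (intro conjI allI impI)
  have FTC: "(h has_integral (H b - H a)) {a..b}" if "a \<le> b" for a b
    by (rule fundamental_theorem_of_calculus_strong[where S="{c}"])
      (use that der cont in \<open>auto simp: has_real_derivative_iff_has_vector_derivative
          intro: continuous_on_subset\<close>)
  show "(\<lambda>x. if x \<in> UNIV then h x else 0) integrable_on cbox a b" for a b
    using FTC[of a b] by (cases "a \<le> b") (auto simp: integrable_on_def)
  fix e :: real assume "e > 0"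
  then have "eventually (\<lambda>x. dist (H x) 0 < e / 2) at_infinity"
    using lim by (intro tendstoD) auto
  then obtain B where B: "\<And>x. norm x \<ge> B \<Longrightarrow> \<bar>H x\<bar> < e / 2"
    by (auto simp: eventually_at_infinity)
  define B' where "B' = max B 1"
  have "norm (integral (cbox a b) (\<lambda>x. if x \<in> UNIV then h x else 0) - 0) < e"
    if "ball 0 B' \<subseteq> cbox a b" for a b
  proof -
    have "a \<le> - B' \<and> B' \<le> b"
    proof -
      have "ball 0 B' = {-B'<..<B'}" by (auto simp: ball_def)
      moreover have "B' > 0" by (simp add: B'_def)
      ultimately show ?thesis using that
        by (simp add: greaterThanLessThan_subseteq_atLeastAtMost_iff)
    qed
    then have "norm a \<ge> B" "norm b \<ge> B" "a \<le> b"
      by (auto simp: B'_def)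
    then have "\<bar>H a\<bar> < e / 2" "\<bar>H b\<bar> < e / 2" "a \<le> b"
      using B by auto
    then show ?thesis
      using integral_unique[OF FTC[of a b]] by auto
  qed
  then show "\<exists>B>0. \<forall>a b. ball 0 B \<subseteq> cbox a b \<longrightarrow>
       norm (integral (cbox a b) (\<lambda>x. if x \<in> UNIV then h x else 0) - 0) < e"
    by (intro exI[of _ B']) (auto simp: B'_def)
qed

text \<open>The common majorant of the singular integrals: one exponent for the singularity at 0,
  another for the decay at infinity.\<close>

definition two_powr :: "real \<Rightarrow> real \<Rightarrow> real \<Rightarrow> real" where
  "two_powr p q s = (if \<bar>s\<bar> \<le> 1 then \<bar>s\<bar> powr p else \<bar>s\<bar> powr q)"

lemma two_powr_nonneg [simp]: "0 \<le> two_powr p q s"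
  by (simp add: two_powr_def)

lemma two_powr_measurable [measurable]: "two_powr p q \<in> borel_measurable borel"
  unfolding two_powr_def by measurable

lemma integrable_two_powr:
  assumes p: "-1 < p" and q: "q < -1"
  shows "integrable lborel (two_powr p q)"
proof -
  let ?f = "\<lambda>s. indicator {0..} s * two_powr p q s"
  have "((\<lambda>s. s powr p) has_integral 1 powr (p+1) / (p+1)) {0..1}"
    using has_integral_powr_from_0[OF p, of 1] by simp
  moreover have "((\<lambda>s. s powr q) has_integral -(1 powr (q+1)) / (q+1)) {1..}"
    by (intro has_integral_powr_to_inf q) simp
  ultimately have 1: "(two_powr p q has_integral 1 powr (p+1) / (p+1)) {0..1}"
      "(two_powr p q has_integral -(1 powr (q+1)) / (q+1)) {1..}"
    by (force intro: has_integral_eq[rotated] simp: two_powr_def)+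
  have "negligible ({0..1} \<inter> {1::real..})"
    by (rule negligible_subset[of "{1}"]) auto
  from has_integral_Un[OF 1 this] obtain I where "(two_powr p q has_integral I) ({0..1} \<union> {1..})"
    by blast
  moreover have "{0..1} \<union> {1::real..} = {0..}" by auto
  ultimately have "(two_powr p q has_integral I) {0..}" by simp
  then have hi: "(?f has_integral I) UNIV"
    by (subst (asm) has_integral_restrict_UNIV[symmetric])
      (auto simp: indicator_def if_distrib of_bool_def if_distribR cong: if_cong)
  have "integral\<^sup>N lborel ?f = I"
    by (rule nn_integral_has_integral_lborel) (use hi in auto)
  then have f: "integrable lborel ?f"
    by (intro integrableI_nonneg) auto
  then have f': "integrable lborel (\<lambda>s. ?f (-s))"
    using lborel_integrable_real_affine[of ?f "-1" 0] by simp
  \<comment> \<open>The half-line restriction plus its reflection dominates the even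
    function.\<close>
  show ?thesis
    by (rule Bochner_Integration.integrable_bound[OF Bochner_Integration.integrable_add[OF f f']])
      (auto simp: indicator_def two_powr_def)
qed

text \<open>Exponent -\<alpha> is the kernel of the velocity; exponent -(2+\<alpha>) is, up to the
  factor -(1+\<alpha>), the derivative of the weight. Oddness of both drives the
  symmetrization.\<close>

definition signed_powr :: "real \<Rightarrow> real \<Rightarrow> real" where
  "signed_powr p s = sgn s * \<bar>s\<bar> powr p"

lemma signed_powr_measurable [measurable]: "signed_powr p \<in> borel_measurable borel"
  unfolding signed_powr_def by measurable

lemma abs_signed_powr: "\<bar>signed_powr p s\<bar> = \<bar>s\<bar> powr p"
  by (auto simp: signed_powr_def abs_mult sgn_if)

lemma signed_powr_minus: "signed_powr p (-s) = - signed_powr p s"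
  by (simp add: signed_powr_def sgn_minus)

lemma powr_deriv_off_zero:
  assumes "x \<noteq> c"
  shows "((\<lambda>y. \<bar>y - c\<bar> powr p) has_real_derivative p * signed_powr (p - 1) (x - c)) (at x)"
proof (cases "c < x")
  case True
  have "((\<lambda>y. (y - c) powr p) has_real_derivative p * (x - c) powr (p - 1)) (at x)"
    using True by (auto intro!: derivative_eq_intros)
  then have "((\<lambda>y. (y - c) powr p) has_real_derivative p * signed_powr (p - 1) (x - c)) (at x)"
    using True by (simp add: signed_powr_def)
  then show ?thesis
    by (rule has_field_derivative_transform_within[where d="x - c"])
      (use True in \<open>auto simp: dist_real_def\<close>)
next
  case False
  then have *: "x < c" using assms by simp
  have "((\<lambda>y. (c - y) powr p) has_real_derivative - (p * (c - x) powr (p - 1))) (at x)"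
    using * by (auto intro!: derivative_eq_intros)
  then have "((\<lambda>y. (c - y) powr p) has_real_derivative p * signed_powr (p - 1) (x - c)) (at x)"
    using * by (simp add: signed_powr_def)
  then show ?thesis
    by (rule has_field_derivative_transform_within[where d="c - x"])
      (use * in \<open>auto simp: dist_real_def\<close>)
qed

text \<open>By oddness of \<open>k\<close> the right-hand side is a(z)(k(y-z) - k(y)) plus the same
  with y and z exchanged. Exchange and reflection leave two cases, 0 < y < z and opposite signs. At
  \<alpha> = 1 both are equalities; for larger \<alpha> they follow by comparing powers of numbers
  in (0,1).\<close>

lemma kernel_symmetrized_lower_bound:
  fixes \<alpha> z y :: real
  assumes \<alpha>: "1 \<le> \<alpha>" and "z \<noteq> 0" "y \<noteq> 0" "z \<noteq> y"
  defines "a \<equiv> signed_powr (- (2 + \<alpha>))" and "k \<equiv> signed_powr (- \<alpha>)"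
  shows "\<bar>z\<bar> powr (-1-\<alpha>) * \<bar>y\<bar> powr (-1-\<alpha>) \<le> (a z - a y) * k (y - z) - a z * k y - a y * k z"
proof -
  have sh: "w powr (-(2+\<alpha>)) = w powr (-\<alpha>) / w^2" "w powr (-(2+\<alpha>)) = w powr (-1-\<alpha>) / w"
      "w powr (-\<alpha>) = w powr (-1-\<alpha>) * w" if "0 < w" for w :: real
  proof -
    have e: "-(2+\<alpha>) = -\<alpha> - 2" "-\<alpha> - 2 = (-1-\<alpha>) - 1" "-1-\<alpha> = -\<alpha> - 1" by auto
    show "w powr (-(2+\<alpha>)) = w powr (-\<alpha>) / w^2"
      unfolding e(1) powr_diff using that by simp
    show "w powr (-(2+\<alpha>)) = w powr (-1-\<alpha>) / w"
      unfolding e(1) e(2) powr_diff[of w _ 1] using that by simp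
    show "w powr (-\<alpha>) = w powr (-1-\<alpha>) * w"
      unfolding e(3) powr_diff using that by simp
  qed
  have pos: "z powr (-1-\<alpha>) * y powr (-1-\<alpha>) \<le> (a z - a y) * k (y - z) - a z * k y - a y * k z"
    if "0 < y" "y < z" for z y
  proof -
    define q where "q = y / z"
    have q: "0 < q" "q < 1" and y: "y = q * z" using that by (auto simp: q_def)
    \<comment> \<open>Replacing \<alpha> by 1 on both factors leaves (1 - q^3) / (1 - q), a finite
      geometric sum.\<close>
    have "q powr (2 + \<alpha>) \<le> q powr 3"
      using q \<alpha> by (intro powr_mono') auto
    then have 1: "q powr (2 + \<alpha>) \<le> q^3" using q by simp
    have "(1 - q) powr 1 \<ge> (1 - q) powr \<alpha>"
      using q \<alpha> by (intro powr_mono') auto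
    then have "1 / (1 - q) \<le> (1 - q) powr (-\<alpha>)"
      using q by (simp add: powr_minus field_simps)
    then have "(1 - q^3) * (1 / (1-q)) \<le> (1 - q powr (2+\<alpha>)) * (1-q) powr (-\<alpha>)"
      using 1 q by (intro mult_mono) (auto simp: power_le_one intro: order_trans[OF _ power_le_one])
    moreover have "(1 - q^3) * (1 / (1-q)) = 1 + q + q^2"
      using q by (simp add: field_simps power2_eq_square power3_eq_cube)
    ultimately have main: "1 + q + q^2 \<le> (1 - q powr (2+\<alpha>)) * (1-q) powr (-\<alpha>)" by simp
    have e: "a z = z powr (-(2+\<alpha>))" "a y = y powr (-(2+\<alpha>))" "k y = y powr (-\<alpha>)"
       "k z = z powr (-\<alpha>)" "k (y - z) = - ((z - y) powr (-\<alpha>))"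
      using that by (auto simp: a_def k_def signed_powr_def)
    have zy: "z - y = z * (1 - q)" by (simp add: y algebra_simps)
    \<comment> \<open>\<open>A\<close> is a(y) k(z). Divided by it, every term depends on q alone,
      and the claim becomes \<open>main\<close> with 1 + q^2 subtracted on both sides.\<close>
    define A where "A = y powr (-(2+\<alpha>)) * z powr (-\<alpha>)"
    have A: "A > 0" using that by (simp add: A_def)
    have "q powr (-(2+\<alpha>)) * q powr (2+\<alpha>) = 1"
      using q by (subst powr_add[symmetric]) simp
    moreover have "y powr (-(2+\<alpha>)) = q powr (-(2+\<alpha>)) * z powr (-(2+\<alpha>))"
      unfolding y by (rule powr_mult)
    then have "A * q powr (2+\<alpha>) = (q powr (-(2+\<alpha>)) * q powr (2+\<alpha>)) * (z powr (-(2+\<alpha>)) * z powr (-\<alpha>))"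
      by (simp only: A_def mult_ac)
    ultimately have Aq: "A * q powr (2+\<alpha>) = z powr (-(2+\<alpha>)) * z powr (-\<alpha>)"
      by (simp only: mult_1)
    then have f1: "(a z - a y) * k (y - z) = A * ((1 - q powr (2+\<alpha>)) * (1-q) powr (-\<alpha>))"
    proof -
      have "(a z - a y) * k (y - z)
          = (y powr (-(2+\<alpha>)) - z powr (-(2+\<alpha>))) * (z powr (-\<alpha>) * (1-q) powr (-\<alpha>))"
      proof -
        have "(z * (1 - q)) powr (-\<alpha>) = z powr (-\<alpha>) * (1-q) powr (-\<alpha>)"
          by (rule powr_mult)
        then show ?thesis unfolding e zy by (simp only: left_diff_distrib minus_mult_right[symmetric] minus_mult_minus)
      qed
      also have "\<dots> = (A - A * q powr (2+\<alpha>)) * (1-q) powr (-\<alpha>)"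
        unfolding Aq unfolding A_def by (simp only: left_diff_distrib mult.assoc)
      finally show ?thesis by (simp only: right_diff_distrib left_diff_distrib mult.assoc mult_1)
    qed
    have f2: "a z * k y = A * q^2"
    proof -
      have "z \<noteq> 0" "y \<noteq> 0" using that by auto
      then show ?thesis unfolding e A_def q_def sh(1)[OF \<open>0 < y\<close>] sh(1)[OF order.strict_trans[OF that]]
        by (simp add: field_simps)
    qed
    have f3: "a y * k z = A" unfolding e A_def ..
    have f4: "z powr (-1-\<alpha>) * y powr (-1-\<alpha>) = A * q"
    proof -
      have "z \<noteq> 0" "y \<noteq> 0" using that by auto
      then show ?thesis unfolding A_def q_def sh(2)[OF \<open>0 < y\<close>] sh(3)[OF order.strict_trans[OF that]]
        by (simp add: field_simps)
    qed
    show ?thesis unfolding f1 f2 f3 f4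
      using mult_left_mono[OF main, of A] A by (simp add: algebra_simps)
  qed
  \<comment> \<open>For opposite signs the terms group into two positive differences of powers. By
    \<open>half\<close> they supply the fractions x/(x+z) and z/(x+z) of the required product, which
    add up to 1.\<close>
  have opp: "z powr (-1-\<alpha>) * x powr (-1-\<alpha>) \<le> (a z - a (-x)) * k (-x - z) - a z * k (-x) - a (-x) * k z"
    if "0 < z" "0 < x" for z x
  proof -
    have half: "w powr (-\<alpha>) - (w + v) powr (-\<alpha>) \<ge> w powr (-\<alpha>) * (v / (w + v))" if "0 < w" "0 < v" for v w
    proof -
      have "(w / (w + v)) powr \<alpha> \<le> (w / (w + v)) powr 1"
        using that \<alpha> by (intro powr_mono') auto
      then have "(w powr \<alpha> / (w + v) powr \<alpha>) / w powr \<alpha> \<le> (w / (w + v)) / w powr \<alpha>"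
        using that by (intro divide_right_mono) (auto simp: powr_divide)
      moreover have "(w powr \<alpha> / (w + v) powr \<alpha>) / w powr \<alpha> = (w + v) powr (-\<alpha>)"
        using that by (simp add: powr_minus inverse_eq_divide)
      moreover have "(w / (w + v)) / w powr \<alpha> = w powr (-\<alpha>) * (w / (w + v))"
        using that by (simp add: powr_minus inverse_eq_divide)
      ultimately have "(w + v) powr (-\<alpha>) \<le> w powr (-\<alpha>) * (w / (w + v))" by simp
      moreover have "w / (w + v) + v / (w + v) = 1"
        using that by (simp add: add_divide_distrib[symmetric])
      then have "w powr (-\<alpha>) * (w / (w + v) + v / (w + v)) = w powr (-\<alpha>)" by simp
      then have "w powr (-\<alpha>) = w powr (-\<alpha>) * (w / (w + v)) + w powr (-\<alpha>) * (v / (w + v))"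
        by (simp only: distrib_left)
      ultimately show ?thesis by linarith
    qed
    have e: "a z = z powr (-(2+\<alpha>))" "a (-x) = - (x powr (-(2+\<alpha>)))" "k (-x) = - (x powr (-\<alpha>))"
       "k z = z powr (-\<alpha>)" "k (-x - z) = - ((z + x) powr (-\<alpha>))"
      using that by (auto simp: a_def k_def signed_powr_def)
    note s = sh(2,3)[OF that(1)] sh(2,3)[OF that(2)]
    have "z powr (-(2+\<alpha>)) * (x powr (-\<alpha>) * (z / (x + z))) + x powr (-(2+\<alpha>)) * (z powr (-\<alpha>) * (x / (z + x)))
        \<le> z powr (-(2+\<alpha>)) * (x powr (-\<alpha>) - (x + z) powr (-\<alpha>)) + x powr (-(2+\<alpha>)) * (z powr (-\<alpha>) - (z + x) powr (-\<alpha>))"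
      using half[of x z] half[of z x] that by (intro add_mono mult_left_mono) auto
    moreover have "z powr (-(2+\<alpha>)) * (x powr (-\<alpha>) * (z / (x + z))) + x powr (-(2+\<alpha>)) * (z powr (-\<alpha>) * (x / (z + x)))
        = z powr (-1-\<alpha>) * x powr (-1-\<alpha>) * ((x + z) / (x + z))"
    proof -
      have alg: "P / z * (Q * x * (z / (x + z))) + Q / x * (P * z * (x / (z + x))) = P * Q * ((x + z) / (x + z))"
        for P Q :: real
      proof -
        have "P * (Q * x) + Q * (P * z) = P * Q * (x + z)" by (simp add: algebra_simps)
        then show ?thesis
          using that by (simp add: add.commute[of z x] add_divide_distrib[symmetric])
      qed
      show ?thesis unfolding s by (rule alg)
    qed
    ultimately show ?thesis using that unfolding e by (simp add: algebra_simps)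
  qed
  have odd: "a (-x) = - a x" "k (-x) = - k x" for x
    by (simp_all add: a_def k_def signed_powr_minus)
  have oddd: "k (y - z) = - k (z - y)" for y z using odd(2)[of "z - y"] by simp
  \<comment> \<open>The claim is invariant under exchanging y and z and under (z, y) to (-z, -y), so
    \<open>pos\<close> and \<open>opp\<close> cover all sign patterns.\<close>
  consider "0 < y" "y < z" | "0 < z" "z < y" | "z < 0" "y < z" | "y < 0" "z < y"
    | "z < 0" "0 < y" | "y < 0" "0 < z"
    using assms by linarith
  then show ?thesis
  proof cases
    case 1 then show ?thesis using pos[of y z] by simp
  next
    case 2 then show ?thesis using pos[of z y] oddd[of y z] by (simp add: algebra_simps)
  next
    case 3 then show ?thesis using pos[of "-z" "-y"] odd oddd[of y z] by (simp add: algebra_simps)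
  next
    case 4 then show ?thesis using pos[of "-y" "-z"] odd oddd[of z y] by (simp add: algebra_simps)
  next
    case 5 then show ?thesis using opp[of "-z" y] odd oddd[of z y] odd(2)[of "y - z"]
      by (simp add: algebra_simps)
  next
    case 6 then show ?thesis using opp[of z "-y"] by simp
  qed
qed

section \<open>The velocity field\<close>

text \<open>Quantitative membership in the Hoelder space of order 1+\<theta>. One constant for all
  three bounds keeps suprema out of the estimates and passes to shifts unchanged.\<close>

definition C1_holder_bound :: "real \<Rightarrow> real \<Rightarrow> (real \<Rightarrow> real) \<Rightarrow> bool" where
  "C1_holder_bound \<theta> M f \<longleftrightarrow> (\<forall>x. f differentiable (at x)) \<and> (\<forall>x. \<bar>f x\<bar> \<le> M) \<and> (\<forall>x. \<bar>deriv f x\<bar> \<le> M) \<and>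
     (\<forall>x y. \<bar>deriv f x - deriv f y\<bar> \<le> M * \<bar>x - y\<bar> powr \<theta>)"

lemma
  assumes "C1_holder_bound \<theta> M f"
  shows C1_holder_boundD: "(f has_real_derivative deriv f x) (at x)" "\<bar>f x\<bar> \<le> M" "\<bar>deriv f x\<bar> \<le> M"
      "\<bar>deriv f x - deriv f y\<bar> \<le> M * \<bar>x - y\<bar> powr \<theta>"
    and C1_holder_bound_nonneg: "0 \<le> M"
proof -
  show "(f has_real_derivative deriv f x) (at x)"
    using assms DERIV_deriv_iff_real_differentiable by (auto simp: C1_holder_bound_def)
  show "\<bar>f x\<bar> \<le> M" "\<bar>deriv f x\<bar> \<le> M" "\<bar>deriv f x - deriv f y\<bar> \<le> M * \<bar>x - y\<bar> powr \<theta>"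
    using assms by (auto simp: C1_holder_bound_def)
  then show "0 \<le> M" by linarith
qed

lemma abs_diff_le_of_deriv_bound:
  fixes f :: "real \<Rightarrow> real"
  assumes "\<And>x. (f has_real_derivative f' x) (at x)" "\<And>x. \<bar>f' x\<bar> \<le> M"
  shows "\<bar>f x - f y\<bar> \<le> M * \<bar>x - y\<bar>"
  using field_differentiable_bound[of UNIV f f' M x y] assms by auto

lemma C1_holder_bound_lipschitz:
  assumes "C1_holder_bound \<theta> M f"
  shows "\<bar>f x - f y\<bar> \<le> M * \<bar>x - y\<bar>"
  by (rule abs_diff_le_of_deriv_bound[of f "deriv f"]) (use C1_holder_boundD[OF assms] in auto)

lemma C1_holder_bound_continuous:
  assumes "C1_holder_bound \<theta> M f"
  shows "continuous_on A f"
  by (rule DERIV_continuous_on) (use C1_holder_boundD(1)[OF assms] in \<open>auto intro: has_field_derivative_at_within\<close>)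

lemma C1_holder_bound_measurable:
  assumes "C1_holder_bound \<theta> M f"
  shows "f \<in> borel_measurable borel"
  by (intro borel_measurable_continuous_onI C1_holder_bound_continuous[OF assms])

lemma C1_holder_bound_mono:
  assumes "C1_holder_bound \<theta> M f" "M \<le> N"
  shows "C1_holder_bound \<theta> N f"
proof -
  have "M * \<bar>x - y\<bar> powr \<theta> \<le> N * \<bar>x - y\<bar> powr \<theta>" for x y
    using assms(2) by (intro mult_right_mono) auto
  then show ?thesis
    using C1_holder_boundD(2-)[OF assms(1)] assms
    unfolding C1_holder_bound_def by (meson order_trans)
qed

lemma
  assumes f: "C1_holder_bound \<theta> M f" and g: "C1_holder_bound \<theta> N g"
  shows C1_holder_bound_add: "C1_holder_bound \<theta> (M + N) (\<lambda>x. f x + g x)"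
    and C1_holder_bound_diff: "C1_holder_bound \<theta> (M + N) (\<lambda>x. f x - g x)"
proof -
  have add: "((\<lambda>x. f x + g x) has_real_derivative deriv f x + deriv g x) (at x)"
    and diff: "((\<lambda>x. f x - g x) has_real_derivative deriv f x - deriv g x) (at x)" for x
    using C1_holder_boundD(1)[OF f] C1_holder_boundD(1)[OF g] by (auto intro!: derivative_intros)
  have ea: "deriv (\<lambda>x. f x + g x) = (\<lambda>x. deriv f x + deriv g x)"
    and ed: "deriv (\<lambda>x. f x - g x) = (\<lambda>x. deriv f x - deriv g x)"
    using add diff by (auto simp: fun_eq_iff DERIV_imp_deriv)
  note b = C1_holder_boundD(2-)[OF f] C1_holder_boundD(2-)[OF g]
  show "C1_holder_bound \<theta> (M + N) (\<lambda>x. f x + g x)"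
    unfolding C1_holder_bound_def ea
  proof (intro conjI allI)
    fix x y
    show "(\<lambda>x. f x + g x) differentiable (at x)" using add real_differentiable_def by blast
    show "\<bar>f x + g x\<bar> \<le> M + N" using b(1)[of x] b(4)[of x] by linarith
    show "\<bar>deriv f x + deriv g x\<bar> \<le> M + N" using b(2)[of x] b(5)[of x] by linarith
    show "\<bar>deriv f x + deriv g x - (deriv f y + deriv g y)\<bar> \<le> (M + N) * \<bar>x - y\<bar> powr \<theta>"
      unfolding distrib_right using b(3)[of x y] b(6)[of x y] by linarith
  qed
  show "C1_holder_bound \<theta> (M + N) (\<lambda>x. f x - g x)"
    unfolding C1_holder_bound_def ed
  proof (intro conjI allI)
    fix x y
    show "(\<lambda>x. f x - g x) differentiable (at x)" using diff real_differentiable_def by blast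
    show "\<bar>f x - g x\<bar> \<le> M + N" using b(1)[of x] b(4)[of x] by linarith
    show "\<bar>deriv f x - deriv g x\<bar> \<le> M + N" using b(2)[of x] b(5)[of x] by linarith
    show "\<bar>deriv f x - deriv g x - (deriv f y - deriv g y)\<bar> \<le> (M + N) * \<bar>x - y\<bar> powr \<theta>"
      unfolding distrib_right using b(3)[of x y] b(6)[of x y] by linarith
  qed
qed

lemma C1_holder_bound_shift:
  assumes f: "C1_holder_bound \<theta> M f"
  shows "C1_holder_bound \<theta> M (\<lambda>x. f (c + x))" "deriv (\<lambda>x. f (c + x)) x = deriv f (c + x)"
proof -
  have d: "((\<lambda>x. f (c + x)) has_real_derivative deriv f (c + x)) (at x)" for x
    using C1_holder_boundD(1)[OF f, of "x + c"] DERIV_shift[of f "deriv f (x + c)" x c] by (simp add: add.commute)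
  then have e: "deriv (\<lambda>x. f (c + x)) = (\<lambda>x. deriv f (c + x))"
    by (auto simp: fun_eq_iff DERIV_imp_deriv)
  show "deriv (\<lambda>x. f (c + x)) x = deriv f (c + x)" by (simp add: e)
  show "C1_holder_bound \<theta> M (\<lambda>x. f (c + x))"
    unfolding C1_holder_bound_def e
  proof (intro conjI allI)
    fix x y
    show "(\<lambda>x. f (c + x)) differentiable (at x)" using d real_differentiable_def by blast
    show "\<bar>deriv f (c + x) - deriv f (c + y)\<bar> \<le> M * \<bar>x - y\<bar> powr \<theta>"
      using C1_holder_boundD(4)[OF f, of "c + x" "c + y"] by simp
  qed (use C1_holder_boundD(2-)[OF f] in auto)
qed

text \<open>The mean value theorem in x, applied to the first difference with step s, whose
  derivative is at most M |s|^\<theta> and at most 2 M. The gain is simultaneous in |x-y| and in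
  s.\<close>

lemma second_difference_bound:
  assumes f: "C1_holder_bound \<theta> M f"
  shows "\<bar>f (x + s) - f x - (f (y + s) - f y)\<bar> \<le> \<bar>x - y\<bar> * (2 * M * min (\<bar>s\<bar> powr \<theta>) 1)"
proof -
  have "\<bar>(f (x + s) - f x) - (f (y + s) - f y)\<bar> \<le> (2 * M * min (\<bar>s\<bar> powr \<theta>) 1) * \<bar>x - y\<bar>"
  proof (rule abs_diff_le_of_deriv_bound[of "\<lambda>x. f (x + s) - f x" "\<lambda>x. deriv f (x + s) - deriv f x"])
    fix x
    show "((\<lambda>x. f (x + s) - f x) has_real_derivative deriv f (x + s) - deriv f x) (at x)"
      using C1_holder_boundD(1)[OF f] by (auto intro!: DERIV_diff simp: DERIV_shift[symmetric])
    have "\<bar>deriv f (x + s) - deriv f x\<bar> \<le> M * \<bar>s\<bar> powr \<theta>"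
      using C1_holder_boundD(4)[OF f, of "x + s" x] by simp
    moreover have "M * \<bar>s\<bar> powr \<theta> \<le> 2 * M * \<bar>s\<bar> powr \<theta>"
      using C1_holder_bound_nonneg[OF f] by (intro mult_right_mono) auto
    ultimately show "\<bar>deriv f (x + s) - deriv f x\<bar> \<le> 2 * M * min (\<bar>s\<bar> powr \<theta>) 1"
      using C1_holder_boundD(3)[OF f, of x] C1_holder_boundD(3)[OF f, of "x + s"]
      by (auto simp: min_def)
  qed
  then show ?thesis by (simp add: mult.commute)
qed

lemma powr_mult_min_le_two_powr:
  assumes "0 < \<theta>"
  shows "\<bar>s\<bar> powr q * min (\<bar>s\<bar> powr \<theta>) 1 \<le> two_powr (\<theta> + q) q s"
proof (cases "\<bar>s\<bar> \<le> 1")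
  case True
  have "\<bar>s\<bar> powr q * min (\<bar>s\<bar> powr \<theta>) 1 \<le> \<bar>s\<bar> powr q * \<bar>s\<bar> powr \<theta>"
    by (intro mult_left_mono) auto
  then show ?thesis using True by (simp add: two_powr_def powr_add mult.commute)
next
  case False
  have "\<bar>s\<bar> powr q * min (\<bar>s\<bar> powr \<theta>) 1 \<le> \<bar>s\<bar> powr q * 1"
    by (intro mult_left_mono) auto
  then show ?thesis using False by (simp add: two_powr_def)
qed

text \<open>The factor \<alpha>-1 comes from differentiating |x-y|^(1-\<alpha>) in the integration
  by parts of \<open>LambdaH_eq\<close>.\<close>

definition flow_const :: "real \<Rightarrow> real" where
  "flow_const \<alpha> = (\<alpha> - 1) * riesz_const (\<alpha> - 1)"

lemma flow_const_pos: "1 < \<alpha> \<Longrightarrow> \<alpha> < 2 \<Longrightarrow> 0 < flow_const \<alpha>"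
  unfolding flow_const_def riesz_const_def
  by (intro mult_pos_pos divide_pos_pos Gamma_real_pos) auto

section \<open>Absolutely convergent form of the velocity, with sup and Lipschitz bounds\<close>

context
  fixes \<alpha> \<theta> M :: real and f :: "real \<Rightarrow> real"
  assumes \<alpha>: "1 < \<alpha>" "\<alpha> < 2" and \<theta>: "\<alpha> - 1 < \<theta>" and f: "C1_holder_bound \<theta> M f"
begin

text \<open>The Lipschitz bound improves the singularity to |s|^(1-\<alpha>), integrable since
  \<alpha> < 2; boundedness leaves the tail |s|^(-\<alpha>), integrable since \<alpha> > 1.\<close>

lemma first_difference_kernel_bound:
  "\<bar>signed_powr (-\<alpha>) s * (f (x + s) - f x)\<bar> \<le> 2 * M * two_powr (1 - \<alpha>) (-\<alpha>) s"
proof -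
  have "\<bar>f (x + s) - f x\<bar> \<le> 2 * M * min (\<bar>s\<bar> powr 1) 1"
    using C1_holder_bound_lipschitz[OF f, of "x + s" x]
      C1_holder_boundD(2)[OF f, of x] C1_holder_boundD(2)[OF f, of "x + s"]
      mult_right_mono[of M "2*M" "\<bar>s\<bar>"] C1_holder_bound_nonneg[OF f]
    by (auto simp: min_def)
  then have "\<bar>signed_powr (-\<alpha>) s * (f (x + s) - f x)\<bar> \<le> \<bar>s\<bar> powr (-\<alpha>) * (2 * M * min (\<bar>s\<bar> powr 1) 1)"
    unfolding abs_mult abs_signed_powr by (intro mult_left_mono) auto
  also have "\<dots> = 2 * M * (\<bar>s\<bar> powr (-\<alpha>) * min (\<bar>s\<bar> powr 1) 1)" by simp
  also have "\<dots> \<le> 2 * M * two_powr (1 + (-\<alpha>)) (-\<alpha>) s"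
    using C1_holder_bound_nonneg[OF f] by (intro mult_left_mono powr_mult_min_le_two_powr) auto
  finally show ?thesis by simp
qed

lemma integrable_first_difference:
  "integrable lborel (\<lambda>s. signed_powr (-\<alpha>) s * (f (x + s) - f x))"
proof -
  note [measurable] = C1_holder_bound_measurable[OF f]
  have "integrable lborel (\<lambda>s. 2 * M * two_powr (1 - \<alpha>) (-\<alpha>) s)"
    using \<alpha> by (intro integrable_mult_right integrable_two_powr) auto
  then show ?thesis
    by (rule Bochner_Integration.integrable_bound)
       (use first_difference_kernel_bound in \<open>auto intro!: order_trans[OF _ abs_ge_self]\<close>)
qed

text \<open>
  The integral in \<^const>\<open>LambdaH\<close> converges only conditionally at infinity; integrating by parts
  turns it into an absolutely convergent one.
\<close>

lemma LambdaH_eq: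
  "LambdaH \<alpha> f x = - flow_const \<alpha> * (LINT s|lborel. signed_powr (-\<alpha>) s * (f (x + s) - f x))"
proof -
  define \<beta> where "\<beta> = \<alpha> - 1"
  define g where "g = (\<lambda>y. signed_powr (-\<alpha>) (y - x) * (f y - f x))"
  \<comment> \<open>Subtracting the constant f(x) from the antiderivative of f' makes
    \<open>H\<close> continuous at the singularity, where it is O(|y-x|^(2-\<alpha>)). At infinity
    it decays like |y-x|^(-\<beta>), since f is bounded.\<close>
  define H where "H = (\<lambda>y. (f y - f x) * \<bar>y - x\<bar> powr (-\<beta>))"
  let ?I = "LINT s|lborel. signed_powr (-\<alpha>) s * (f (x + s) - f x)"
  have M: "0 \<le> M" using C1_holder_bound_nonneg[OF f] .
  have gi: "integrable lborel g"
    using lborel_integrable_real_affine[OF integrable_first_difference[of x], of 1 "-x"]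
    by (simp add: g_def)
  have gI: "integral\<^sup>L lborel g = ?I"
    using lborel_integral_real_affine[of 1 g x] by (simp add: g_def)
  have g: "(g has_integral ?I) UNIV"
    using has_integral_integral_lborel[OF gi] by (simp add: gI)
  have "((\<lambda>y. deriv f y / \<bar>x - y\<bar> powr \<beta> - \<beta> * g y) has_integral 0) UNIV"
  proof (rule has_integral_derivative_vanishing_at_infinity[of H x])
    show "(H has_real_derivative (deriv f y / \<bar>x - y\<bar> powr \<beta> - \<beta> * g y)) (at y)" if "y \<noteq> x" for y
    proof -
      have "- \<beta> - 1 = - \<alpha>" by (simp add: \<beta>_def)
      then have "((\<lambda>y. \<bar>y - x\<bar> powr (-\<beta>)) has_real_derivative - \<beta> * signed_powr (- \<alpha>) (y - x)) (at y)"
        using powr_deriv_off_zero[OF that, of "-\<beta>"] by simp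
      then have "(H has_real_derivative (deriv f y - 0) * \<bar>y - x\<bar> powr (-\<beta>) + - \<beta> * signed_powr (- \<alpha>) (y - x) * (f y - f x)) (at y)"
        unfolding H_def by (intro DERIV_mult DERIV_diff C1_holder_boundD(1)[OF f] DERIV_const)
      then show ?thesis
        by (simp add: g_def powr_minus divide_inverse abs_minus_commute mult.assoc)
    qed
    then have "isCont H y" if "y \<noteq> x" for y using that DERIV_isCont by blast
    moreover have "isCont H x"
      unfolding isCont_def
    proof (rule Lim_null_comparison[where g="\<lambda>y. M * \<bar>y - x\<bar> powr (2 - \<alpha>)", THEN tendsto_eq_rhs])
      show "\<forall>\<^sub>F y in at x. norm (H y) \<le> M * \<bar>y - x\<bar> powr (2 - \<alpha>)"
      proof (intro eventually_at_filter[THEN iffD2] always_eventually allI impI)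
        fix y assume "y \<noteq> x"
        have "norm (H y) \<le> M * \<bar>y - x\<bar> * \<bar>y - x\<bar> powr (-\<beta>)"
          unfolding H_def using C1_holder_bound_lipschitz[OF f, of y x] by (simp add: abs_mult mult_right_mono)
        also have "\<dots> = M * \<bar>y - x\<bar> powr (1 + (-\<beta>))"
          using \<open>y \<noteq> x\<close> by (subst powr_add) auto
        finally show "norm (H y) \<le> M * \<bar>y - x\<bar> powr (2 - \<alpha>)" by (simp add: \<beta>_def)
      qed
      have "((\<lambda>y. \<bar>y - x\<bar>) \<longlongrightarrow> 0) (at x)"
        by (auto intro!: tendsto_eq_intros)
      then have "((\<lambda>y. \<bar>y - x\<bar> powr (2 - \<alpha>)) \<longlongrightarrow> 0) (at x)"
        by (rule tendsto_zero_powrI[OF _ tendsto_const]) (use \<alpha> in auto)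
      then show "((\<lambda>y. M * \<bar>y - x\<bar> powr (2 - \<alpha>)) \<longlongrightarrow> 0) (at x)"
        by (rule tendsto_mult_right_zero)
    qed (simp add: H_def)
    ultimately show "continuous_on UNIV H"
      by (metis continuous_at_imp_continuous_on)
    show "(H \<longlongrightarrow> 0) at_infinity"
    proof (rule Lim_null_comparison)
      have "norm (H y) \<le> 2 * M * \<bar>y - x\<bar> powr (-\<beta>)" for y
      proof -
        have "\<bar>f y - f x\<bar> \<le> 2 * M"
          using C1_holder_boundD(2)[OF f, of x] C1_holder_boundD(2)[OF f, of y] by linarith
        then show ?thesis unfolding H_def by (simp add: abs_mult mult_right_mono)
      qed
      then show "\<forall>\<^sub>F y in at_infinity. norm (H y) \<le> 2 * M * \<bar>y - x\<bar> powr (-\<beta>)" by simp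
      show "((\<lambda>y. 2 * M * \<bar>y - x\<bar> powr (-\<beta>)) \<longlongrightarrow> 0) at_infinity"
        using \<alpha> by (intro tendsto_mult_right_zero powr_tendsto_0_at_infinity) (simp add: \<beta>_def)
    qed
  qed
  from has_integral_add[OF this has_integral_mult_right[OF g, of \<beta>]]
  have "((\<lambda>y. deriv f y / \<bar>x - y\<bar> powr \<beta>) has_integral \<beta> * ?I) UNIV" by simp
  then show ?thesis
    unfolding LambdaH_def riesz_potential_def \<beta>_def[symmetric] flow_const_def
    by (subst integral_unique) auto
qed

lemma abs_LambdaH_le:
  "\<bar>LambdaH \<alpha> f x\<bar> \<le> flow_const \<alpha> * (2 * (LINT s|lborel. two_powr (1 - \<alpha>) (-\<alpha>) s)) * M"
proof -
  have "\<bar>LINT s|lborel. signed_powr (-\<alpha>) s * (f (x + s) - f x)\<bar> \<le> (LINT s|lborel. 2 * M * two_powr (1 - \<alpha>) (-\<alpha>) s)"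
    using first_difference_kernel_bound \<alpha>
    by (intro integral_abs_bound_integral integrable_first_difference integrable_mult_right integrable_two_powr) auto
  then have "\<bar>LINT s|lborel. signed_powr (-\<alpha>) s * (f (x + s) - f x)\<bar> \<le> 2 * M * (LINT s|lborel. two_powr (1 - \<alpha>) (-\<alpha>) s)"
    by simp
  then have "flow_const \<alpha> * \<bar>LINT s|lborel. signed_powr (-\<alpha>) s * (f (x + s) - f x)\<bar> \<le> flow_const \<alpha> * (2 * M * (LINT s|lborel. two_powr (1 - \<alpha>) (-\<alpha>) s))"
    using flow_const_pos[OF \<alpha>] by (intro mult_left_mono) auto
  then show ?thesis
    unfolding LambdaH_eq abs_mult using flow_const_pos[OF \<alpha>] by (simp add: mult_ac)
qed

lemma second_difference_kernel_bound:
  "\<bar>signed_powr (-\<alpha>) s * (f (x + s) - f x - (f (y + s) - f y))\<bar>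
     \<le> \<bar>x - y\<bar> * (2 * M * two_powr (\<theta> - \<alpha>) (-\<alpha>) s)"
proof -
  have "\<bar>signed_powr (-\<alpha>) s * (f (x + s) - f x - (f (y + s) - f y))\<bar>
      \<le> \<bar>s\<bar> powr (-\<alpha>) * (\<bar>x - y\<bar> * (2 * M * min (\<bar>s\<bar> powr \<theta>) 1))"
    unfolding abs_mult abs_signed_powr by (intro mult_left_mono second_difference_bound f) auto
  also have "\<dots> = \<bar>x - y\<bar> * (2 * M * (\<bar>s\<bar> powr (-\<alpha>) * min (\<bar>s\<bar> powr \<theta>) 1))" by simp
  also have "\<dots> \<le> \<bar>x - y\<bar> * (2 * M * two_powr (\<theta> + (-\<alpha>)) (-\<alpha>) s)"
    using C1_holder_bound_nonneg[OF f] \<theta> \<alpha> by (intro mult_left_mono powr_mult_min_le_two_powr) auto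
  finally show ?thesis by simp
qed

lemma LambdaH_diff_eq:
  "integrable lborel (\<lambda>s. signed_powr (-\<alpha>) s * (f (x + s) - f x - (f (y + s) - f y)))"
  "LambdaH \<alpha> f x - LambdaH \<alpha> f y =
     - flow_const \<alpha> * (LINT s|lborel. signed_powr (-\<alpha>) s * (f (x + s) - f x - (f (y + s) - f y)))"
proof -
  show "integrable lborel (\<lambda>s. signed_powr (-\<alpha>) s * (f (x + s) - f x - (f (y + s) - f y)))"
    using Bochner_Integration.integrable_diff[OF integrable_first_difference integrable_first_difference, of x y]
    by (simp add: algebra_simps)
  have "(LINT s|lborel. signed_powr (-\<alpha>) s * (f (x + s) - f x - (f (y + s) - f y))) =
     (LINT s|lborel. signed_powr (-\<alpha>) s * (f (x + s) - f x)) - (LINT s|lborel. signed_powr (-\<alpha>) s * (f (y + s) - f y))"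
    by (subst Bochner_Integration.integral_diff[symmetric, OF integrable_first_difference integrable_first_difference])
       (simp add: algebra_simps)
  then show "LambdaH \<alpha> f x - LambdaH \<alpha> f y =
     - flow_const \<alpha> * (LINT s|lborel. signed_powr (-\<alpha>) s * (f (x + s) - f x - (f (y + s) - f y)))"
    unfolding LambdaH_eq by (simp only: right_diff_distrib)
qed

text \<open>Here \<theta> > \<alpha>-1 enters: the second difference gives the majorant
  |s|^(\<theta>-\<alpha>) near 0, integrable exactly then. This bound is what yields global
  characteristics.\<close>

lemma LambdaH_lipschitz:
  "\<bar>LambdaH \<alpha> f x - LambdaH \<alpha> f y\<bar>
     \<le> flow_const \<alpha> * (2 * (LINT s|lborel. two_powr (\<theta> - \<alpha>) (-\<alpha>) s)) * M * \<bar>x - y\<bar>"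
proof -
  let ?I = "LINT s|lborel. signed_powr (-\<alpha>) s * (f (x + s) - f x - (f (y + s) - f y))"
  have "\<bar>?I\<bar> \<le> (LINT s|lborel. \<bar>x - y\<bar> * (2 * M * two_powr (\<theta> - \<alpha>) (-\<alpha>) s))"
    using second_difference_kernel_bound \<alpha> \<theta>
    by (intro integral_abs_bound_integral LambdaH_diff_eq integrable_mult_right integrable_two_powr) auto
  then have "flow_const \<alpha> * \<bar>?I\<bar> \<le> flow_const \<alpha> * (\<bar>x - y\<bar> * (2 * M * (LINT s|lborel. two_powr (\<theta> - \<alpha>) (-\<alpha>) s)))"
    using flow_const_pos[OF \<alpha>] by (intro mult_left_mono) auto
  then show ?thesis
    unfolding LambdaH_diff_eq abs_mult using flow_const_pos[OF \<alpha>] by (simp add: mult_ac)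
qed

end

text \<open>Linearity is read off the absolutely convergent form. It turns the bound on
  \<open>LambdaH\<close> into continuity of the velocity in time.\<close>

lemma LambdaH_diff:
  assumes \<alpha>: "1 < \<alpha>" "\<alpha> < 2" and \<theta>: "\<alpha> - 1 < \<theta>"
    and f: "C1_holder_bound \<theta> M f" and g: "C1_holder_bound \<theta> N g"
  shows "LambdaH \<alpha> (\<lambda>x. f x - g x) x = LambdaH \<alpha> f x - LambdaH \<alpha> g x"
  unfolding LambdaH_eq[OF \<alpha> \<theta> f] LambdaH_eq[OF \<alpha> \<theta> g]
    LambdaH_eq[OF \<alpha> \<theta> C1_holder_bound_diff[OF f g]]
  by (subst right_diff_distrib[symmetric],
      subst Bochner_Integration.integral_diff[symmetric,
        OF integrable_first_difference[OF \<alpha> \<theta> f, of x] integrable_first_difference[OF \<alpha> \<theta> g, of x]])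
    (simp add: algebra_simps)

section \<open>The quadratic lower bound\<close>

definition trunc_kernel :: "real \<Rightarrow> real \<Rightarrow> real \<Rightarrow> real" where
  "trunc_kernel \<alpha> r s = (if r < \<bar>s\<bar> then signed_powr (-\<alpha>) s else 0)"

lemma trunc_kernel_measurable [measurable]: "trunc_kernel \<alpha> r \<in> borel_measurable borel"
  unfolding trunc_kernel_def by measurable

lemma abs_trunc_kernel_le:
  assumes "0 < r" "r \<le> 1" "0 < \<alpha>"
  shows "\<bar>trunc_kernel \<alpha> r s\<bar> \<le> r powr (-\<alpha>) * two_powr 0 (-\<alpha>) s"
proof -
  have 1: "1 \<le> r powr (-\<alpha>)"
    using powr_mono2'[of "-\<alpha>" r 1] assms by simp
  consider "\<bar>s\<bar> \<le> r" | "r < \<bar>s\<bar>" "\<bar>s\<bar> \<le> 1" | "1 < \<bar>s\<bar>" "r < \<bar>s\<bar>" using assms by linarith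
  then show ?thesis
  proof cases
    case 1 then show ?thesis by (simp add: trunc_kernel_def)
  next
    case 2
    then have "\<bar>s\<bar> powr (-\<alpha>) \<le> r powr (-\<alpha>)"
      using assms by (intro powr_mono2') auto
    then show ?thesis using 2 assms by (auto simp: trunc_kernel_def abs_signed_powr two_powr_def)
  next
    case 3
    then have "1 * \<bar>s\<bar> powr (-\<alpha>) \<le> r powr (-\<alpha>) * \<bar>s\<bar> powr (-\<alpha>)"
      using 1 by (intro mult_right_mono) auto
    then show ?thesis using 3 by (simp add: trunc_kernel_def abs_signed_powr two_powr_def)
  qed
qed

lemma integrable_trunc_kernel:
  assumes "0 < r" "r \<le> 1" "1 < \<alpha>"
  shows "integrable lborel (trunc_kernel \<alpha> r)"
proof (rule Bochner_Integration.integrable_bound)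
  show "integrable lborel (\<lambda>s. r powr (-\<alpha>) * two_powr 0 (-\<alpha>) s)"
    using assms by (intro integrable_mult_right integrable_two_powr) auto
qed (use abs_trunc_kernel_le[of r \<alpha>] assms in \<open>auto intro!: order_trans[OF _ abs_ge_self]\<close>)

text \<open>By oddness. Hence the constant term -w(z) of the first difference drops out under the
  truncated kernel.\<close>

lemma integral_trunc_kernel: "(LINT s|lborel. trunc_kernel \<alpha> r s) = 0"
proof -
  have "(LINT s|lborel. trunc_kernel \<alpha> r s) = (LINT s|lborel. - trunc_kernel \<alpha> r s)"
    using lborel_integral_real_affine[of "-1" "trunc_kernel \<alpha> r" 0]
    by (simp add: trunc_kernel_def signed_powr_minus if_distrib[of uminus] cong: if_cong)
  then show ?thesis by simp
qed

text \<open>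
  Truncating to \<open>|z|, |y|, |y - z| > r\<close>, a region symmetric in \<open>y\<close> and \<open>z\<close>, makes the double
  integral absolutely convergent, so that its variables may be exchanged.
\<close>

definition trunc_product :: "real \<Rightarrow> (real \<Rightarrow> real) \<Rightarrow> real \<Rightarrow> real \<Rightarrow> real \<Rightarrow> real" where
  "trunc_product \<alpha> w r z y = (if r < \<bar>z\<bar> \<and> r < \<bar>y\<bar> \<and> r < \<bar>y - z\<bar>
     then signed_powr (-(2+\<alpha>)) z * w z * (w y * (signed_powr (-\<alpha>) (y - z) - signed_powr (-\<alpha>) y)) else 0)"

text \<open>Both windows, around 0 and around z, are removed from both kernel terms, as the
  symmetric region demands. Truncating the kernel in \<open>drift\<close> would remove from each
  term only its own window; \<open>trunc_drift_approx\<close> measures the mismatch.\<close>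

definition trunc_drift :: "real \<Rightarrow> (real \<Rightarrow> real) \<Rightarrow> real \<Rightarrow> real \<Rightarrow> real" where
  "trunc_drift \<alpha> w r z = (LINT y|lborel. (if r < \<bar>y\<bar> \<and> r < \<bar>y - z\<bar>
     then w y * (signed_powr (-\<alpha>) (y - z) - signed_powr (-\<alpha>) y) else 0))"

text \<open>
  Since \<open>w\<close> will be \<open>u t\<close> recentred at \<open>X\<close>, this is, up to the factor \<open>- flow_const \<alpha>\<close>,
  the velocity at \<open>X + z\<close> relative to the velocity at \<open>X\<close>.
\<close>

definition drift :: "real \<Rightarrow> (real \<Rightarrow> real) \<Rightarrow> real \<Rightarrow> real" where
  "drift \<alpha> w z = (LINT s|lborel. signed_powr (-\<alpha>) s * (w (z + s) - w z - (w (0 + s) - w 0)))"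

section \<open>Nonnegative profiles vanishing at the origin together with their slope\<close>

context
  fixes \<alpha> \<theta> M :: real and w :: "real \<Rightarrow> real"
  assumes \<alpha>: "1 < \<alpha>" "\<alpha> < 2" and \<theta>: "\<alpha> - 1 < \<theta>" and w: "C1_holder_bound \<theta> M w"
    and nonneg: "\<And>z. 0 \<le> w z" and w0: "w 0 = 0" "deriv w 0 = 0"
begin

lemma profile_measurable [measurable]: "w \<in> borel_measurable borel"
  by (rule C1_holder_bound_measurable[OF w])

lemma profile_bound_nonneg: "0 \<le> M" using C1_holder_bound_nonneg[OF w] .

lemma deriv_profile_le_powr: "\<bar>deriv w z\<bar> \<le> M * \<bar>z\<bar> powr \<theta>"
  using C1_holder_boundD(4)[OF w, of z 0] w0 by simp

text \<open>The mean value inequality on the interval of radius |z| turns the growth of w' into one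
  more power for w. Against the weight this leaves |z|^(\<theta>-\<alpha>), integrable at 0.\<close>

lemma profile_le_powr: "w z \<le> M * \<bar>z\<bar> powr (1 + \<theta>)"
proof -
  have "norm (w z - w 0) \<le> (M * \<bar>z\<bar> powr \<theta>) * norm (z - 0)"
  proof (rule field_differentiable_bound[of "{-\<bar>z\<bar>..\<bar>z\<bar>}" w "deriv w"])
    fix x assume x: "x \<in> {-\<bar>z\<bar>..\<bar>z\<bar>}"
    show "(w has_field_derivative deriv w x) (at x within {- \<bar>z\<bar>..\<bar>z\<bar>})"
      using C1_holder_boundD(1)[OF w] by (rule has_field_derivative_at_within)
    have "\<bar>x\<bar> powr \<theta> \<le> \<bar>z\<bar> powr \<theta>"
      using x \<theta> \<alpha> by (intro powr_mono2) auto
    then show "norm (deriv w x) \<le> M * \<bar>z\<bar> powr \<theta>"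
      using deriv_profile_le_powr[of x] mult_left_mono[OF _ profile_bound_nonneg] by fastforce
  qed auto
  then show ?thesis
    using w0 nonneg by (cases "z = 0") (auto simp: powr_add mult_ac)
qed

lemma profile_weight_le: "w z * \<bar>z\<bar> powr (-1-\<alpha>) \<le> M * two_powr (\<theta> - \<alpha>) (-1-\<alpha>) z"
proof (cases "\<bar>z\<bar> \<le> 1")
  case True
  have "w z * \<bar>z\<bar> powr (-1-\<alpha>) \<le> (M * \<bar>z\<bar> powr (1 + \<theta>)) * \<bar>z\<bar> powr (-1-\<alpha>)"
    by (intro mult_right_mono profile_le_powr) auto
  also have "\<dots> = M * \<bar>z\<bar> powr (\<theta> - \<alpha>)" by (simp add: powr_add[symmetric])
  finally show ?thesis using True by (simp add: two_powr_def)
next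
  case False
  then show ?thesis
    using C1_holder_boundD(2)[OF w, of z] by (auto simp: two_powr_def intro!: mult_right_mono)
qed

lemma integrable_profile_weight: "integrable lborel (\<lambda>z. w z * \<bar>z\<bar> powr (-1-\<alpha>))"
proof (rule Bochner_Integration.integrable_bound)
  show "integrable lborel (\<lambda>z. M * two_powr (\<theta> - \<alpha>) (-1-\<alpha>) z)"
    using \<alpha> \<theta> by (intro integrable_mult_right integrable_two_powr) auto
qed (use profile_weight_le nonneg in \<open>auto intro!: order_trans[OF _ abs_ge_self]\<close>)

text \<open>Since 1+\<theta> > \<alpha>, the vanishing of w absorbs the singularity of the kernel at
  0. A window of length 2r therefore contributes at most 2 M r, wherever it lies.\<close>

lemma abs_kernel_profile_le:
  "\<bar>signed_powr (-\<alpha>) y * w y\<bar> \<le> M"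
proof (cases "\<bar>y\<bar> \<le> 1")
  case True
  have "\<bar>signed_powr (-\<alpha>) y * w y\<bar> \<le> \<bar>y\<bar> powr (-\<alpha>) * (M * \<bar>y\<bar> powr (1 + \<theta>))"
    unfolding abs_mult abs_signed_powr using nonneg profile_le_powr by (intro mult_left_mono) auto
  also have "\<dots> = M * \<bar>y\<bar> powr (1 + \<theta> - \<alpha>)" by (simp add: powr_add[symmetric])
  also have "\<dots> \<le> M * 1"
    using True \<alpha> \<theta> profile_bound_nonneg by (intro mult_left_mono powr_le1) auto
  finally show ?thesis by simp
next
  case False
  have "\<bar>signed_powr (-\<alpha>) y * w y\<bar> \<le> 1 * M"
    unfolding abs_mult abs_signed_powr
    using False \<alpha> C1_holder_boundD(2)[OF w, of y] powr_mono2'[of "-\<alpha>" 1 "\<bar>y\<bar>"]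
    by (intro mult_mono) auto
  then show ?thesis by simp
qed

lemma drift_bound_const_nonneg: "0 \<le> 2 * M * (LINT s|lborel. two_powr (\<theta> - \<alpha>) (-\<alpha>) s)"
  using profile_bound_nonneg by (intro mult_nonneg_nonneg integral_nonneg) auto

text \<open>Stated for any kernel \<open>q\<close> dominated by the singular one, so that the same
  O(z) bound serves \<open>drift\<close> and its truncations, uniformly in r.\<close>

lemma abs_drift_integral_le:
  assumes "\<And>s. \<bar>q s\<bar> \<le> \<bar>signed_powr (-\<alpha>) s\<bar>" and [measurable]: "q \<in> borel_measurable borel"
  shows "\<bar>LINT s|lborel. q s * (w (z + s) - w z - (w (0 + s) - w 0))\<bar>
    \<le> \<bar>z\<bar> * (2 * M * (LINT s|lborel. two_powr (\<theta> - \<alpha>) (-\<alpha>) s))"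
proof -
  have b: "\<bar>q s * (w (z + s) - w z - (w (0 + s) - w 0))\<bar> \<le> \<bar>z\<bar> * (2 * M * two_powr (\<theta> - \<alpha>) (-\<alpha>) s)" for s
  proof -
    have "\<bar>q s * (w (z + s) - w z - (w (0 + s) - w 0))\<bar> \<le> \<bar>signed_powr (-\<alpha>) s * (w (z + s) - w z - (w (0 + s) - w 0))\<bar>"
      unfolding abs_mult by (intro mult_right_mono assms) auto
    also have "\<dots> \<le> \<bar>z\<bar> * (2 * M * two_powr (\<theta> - \<alpha>) (-\<alpha>) s)"
      using second_difference_kernel_bound[OF \<alpha> \<theta> w, of s z 0] by simp
    finally show ?thesis .
  qed
  have i: "integrable lborel (\<lambda>s. \<bar>z\<bar> * (2 * M * two_powr (\<theta> - \<alpha>) (-\<alpha>) s))"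
    using \<alpha> \<theta> by (intro integrable_mult_right integrable_two_powr) auto
  have "\<bar>LINT s|lborel. q s * (w (z + s) - w z - (w (0 + s) - w 0))\<bar>
     \<le> (LINT s|lborel. \<bar>z\<bar> * (2 * M * two_powr (\<theta> - \<alpha>) (-\<alpha>) s))"
    by (rule integral_abs_bound_integral[OF _ i b], rule Bochner_Integration.integrable_bound[OF i])
       (use b in \<open>auto intro!: order_trans[OF _ abs_ge_self]\<close>)
  then show ?thesis by simp
qed

text \<open>After the change of variables y = z + s, the integral against the truncated kernel
  differs from \<open>trunc_drift\<close> only by \<open>E1\<close>, the first kernel term on the
  window around 0, and \<open>E2\<close>, the second one on the window around z. Each is at most M
  on an interval of length 2r.\<close>

lemma trunc_drift_approx:
  assumes r: "0 < r" "r \<le> 1"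
  shows "\<bar>trunc_drift \<alpha> w r z - (LINT s|lborel. trunc_kernel \<alpha> r s * (w (z + s) - w z - (w (0 + s) - w 0)))\<bar> \<le> 4 * M * r"
proof -
  let ?k = "trunc_kernel \<alpha> r"
  note ki = integrable_trunc_kernel[OF r \<alpha>(1)]
  have bdd: "integrable lborel (\<lambda>s. ?k s * g s)" if [measurable]: "g \<in> borel_measurable borel" and "\<And>s. \<bar>g s\<bar> \<le> M" for g
    by (rule Bochner_Integration.integrable_bound[OF integrable_mult_right[OF ki, of M]])
       (use that in \<open>auto simp: abs_mult mult_left_mono profile_bound_nonneg mult.commute[of M]\<close>)
  have wM: "\<bar>w x\<bar> \<le> M" for x using C1_holder_boundD(2)[OF w] .
  have B: "integrable lborel (\<lambda>y. ?k y * w y)" by (rule bdd) (use wM in auto)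
  have A0: "integrable lborel (\<lambda>s. ?k s * w (z + s))" by (rule bdd) (use wM in auto)
  have A: "integrable lborel (\<lambda>y. ?k (y - z) * w y)"
    using lborel_integrable_real_affine[OF A0, of 1 "-z"] by simp
  have AI: "(LINT y|lborel. ?k (y - z) * w y) = (LINT s|lborel. ?k s * w (z + s))"
    by (subst lborel_integral_real_affine[where c=1 and t=z]) auto
  have C: "integrable lborel (\<lambda>s. ?k s * w z)" by (rule integrable_mult_left[OF ki])
  have T: "(LINT s|lborel. ?k s * (w (z + s) - w z - (w (0 + s) - w 0)))
      = (LINT y|lborel. ?k (y - z) * w y) - (LINT y|lborel. ?k y * w y)"
  proof -
    have "(LINT s|lborel. ?k s * (w (z + s) - w z - (w (0 + s) - w 0)))
      = (LINT s|lborel. (?k s * w (z + s) - ?k s * w s) - ?k s * w z)"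
      by (simp add: w0 algebra_simps)
    also have "\<dots> = (LINT s|lborel. ?k s * w (z + s)) - (LINT y|lborel. ?k y * w y) - (LINT s|lborel. ?k s * w z)"
      using A0 B C by simp
    finally show ?thesis using integral_trunc_kernel[of \<alpha> r] by (simp add: AI)
  qed
  define E1 where "E1 = (\<lambda>y. if \<bar>y\<bar> \<le> r then ?k (y - z) * w y else 0)"
  define E2 where "E2 = (\<lambda>y. if \<bar>y - z\<bar> \<le> r then ?k y * w y else 0)"
  have [measurable]: "E1 \<in> borel_measurable borel" "E2 \<in> borel_measurable borel"
    unfolding E1_def E2_def by measurable
  have E1i: "integrable lborel E1"
    by (rule Bochner_Integration.integrable_bound[OF A]) (auto simp: E1_def)
  have E2i: "integrable lborel E2"
    by (rule Bochner_Integration.integrable_bound[OF B]) (auto simp: E2_def)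
  have "\<bar>E1 y\<bar> \<le> M * indicator {-r..r} y" for y
  proof (cases "\<bar>y\<bar> \<le> r")
    case True
    \<comment> \<open>On this window the kernel is only bounded by r^(-\<alpha>), but w is at most M
      r^(1+\<theta>) there; the product has a positive power of r, and r \<le> 1.\<close>
    have "\<bar>?k (y - z)\<bar> \<le> r powr (-\<alpha>)"
      using r \<alpha> powr_mono2'[of "-\<alpha>" r "\<bar>y - z\<bar>"] by (auto simp: trunc_kernel_def abs_signed_powr)
    moreover have "w y \<le> M * r powr (1 + \<theta>)"
      using profile_le_powr[of y] powr_mono2[of "1 + \<theta>" "\<bar>y\<bar>" r] True \<alpha> \<theta> mult_left_mono[OF _ profile_bound_nonneg] by fastforce
    ultimately have "\<bar>?k (y - z) * w y\<bar> \<le> r powr (-\<alpha>) * (M * r powr (1 + \<theta>))"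
      unfolding abs_mult using nonneg by (intro mult_mono) auto
    also have "\<dots> = M * r powr (1 + \<theta> - \<alpha>)" by (simp add: powr_add[symmetric])
    also have "\<dots> \<le> M * 1" using r \<alpha> \<theta> profile_bound_nonneg by (intro mult_left_mono powr_le1) auto
    finally show ?thesis using True by (auto simp: E1_def indicator_def)
  qed (simp add: E1_def profile_bound_nonneg)
  then have 1: "\<bar>LINT y|lborel. E1 y\<bar> \<le> (LINT y|lborel. M * indicator {-r..r} y)"
    by (intro integral_abs_bound_integral E1i integrable_mult_right)
       (auto intro!: integrable_real_indicator emeasure_bounded_finite)
  have "\<bar>E2 y\<bar> \<le> M * indicator {z-r..z+r} y" for y
    using abs_kernel_profile_le[of y] profile_bound_nonneg by (auto simp: E2_def trunc_kernel_def indicator_def)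
  then have 2: "\<bar>LINT y|lborel. E2 y\<bar> \<le> (LINT y|lborel. M * indicator {z-r..z+r} y)"
    by (intro integral_abs_bound_integral E2i integrable_mult_right)
       (auto intro!: integrable_real_indicator emeasure_bounded_finite)
  have "trunc_drift \<alpha> w r z = (LINT y|lborel. (?k (y - z) * w y - ?k y * w y) - E1 y + E2 y)"
    unfolding trunc_drift_def
    by (intro Bochner_Integration.integral_cong) (auto simp: E1_def E2_def trunc_kernel_def algebra_simps)
  also have "\<dots> = (LINT y|lborel. ?k (y - z) * w y) - (LINT y|lborel. ?k y * w y) - (LINT y|lborel. E1 y) + (LINT y|lborel. E2 y)"
    using A B E1i E2i by simp
  finally have "trunc_drift \<alpha> w r z - (LINT s|lborel. trunc_kernel \<alpha> r s * (w (z + s) - w z - (w (0 + s) - w 0)))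
     = (LINT y|lborel. E2 y) - (LINT y|lborel. E1 y)" unfolding T by simp
  moreover have "(LINT y|lborel. M * indicator {-r..r} y) = 2 * M * r" "(LINT y|lborel. M * indicator {z-r..z+r} y) = 2 * M * r"
    using r by auto
  ultimately show ?thesis using 1 2 by linarith
qed

text \<open>For r < |z| the additive error 4 M r is absorbed into a multiple of |z|, which gives a
  majorant independent of r for the passage to the limit.\<close>

lemma abs_trunc_drift_le:
  assumes r: "0 < r" "r \<le> 1" "r < \<bar>z\<bar>"
  shows "\<bar>trunc_drift \<alpha> w r z\<bar> \<le> \<bar>z\<bar> * (2 * M * (LINT s|lborel. two_powr (\<theta> - \<alpha>) (-\<alpha>) s) + 4 * M)"
proof -
  have "\<bar>LINT s|lborel. trunc_kernel \<alpha> r s * (w (z + s) - w z - (w (0 + s) - w 0))\<bar>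
     \<le> \<bar>z\<bar> * (2 * M * (LINT s|lborel. two_powr (\<theta> - \<alpha>) (-\<alpha>) s))"
    by (rule abs_drift_integral_le) (auto simp: trunc_kernel_def)
  moreover have "4 * M * r \<le> \<bar>z\<bar> * (4 * M)"
    using mult_left_mono[of r "\<bar>z\<bar>" "4 * M"] r profile_bound_nonneg by (simp add: mult_ac)
  ultimately show ?thesis
    using trunc_drift_approx[OF r(1,2), of z] unfolding distrib_left by linarith
qed

lemma trunc_drift_tendsto:
  assumes r: "\<And>n::nat. 0 < r n" "\<And>n. r n \<le> 1" "r \<longlonglongrightarrow> 0"
  shows "(\<lambda>n. trunc_drift \<alpha> w (r n) z) \<longlonglongrightarrow> drift \<alpha> w z"
proof -
  let ?T = "\<lambda>n. LINT s|lborel. trunc_kernel \<alpha> (r n) s * (w (z + s) - w z - (w (0 + s) - w 0))"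
  have "?T \<longlonglongrightarrow> drift \<alpha> w z"
    unfolding drift_def
  proof (rule integral_dominated_convergence[where w="\<lambda>s. \<bar>signed_powr (-\<alpha>) s * (w (z + s) - w z - (w (0 + s) - w 0))\<bar>"])
    show "integrable lborel (\<lambda>s. \<bar>signed_powr (-\<alpha>) s * (w (z + s) - w z - (w (0 + s) - w 0))\<bar>)"
      by (intro integrable_abs LambdaH_diff_eq[OF \<alpha> \<theta> w])
    have "(\<lambda>n. trunc_kernel \<alpha> (r n) s) \<longlonglongrightarrow> signed_powr (-\<alpha>) s" for s
    proof (cases "s = 0")
      case True then show ?thesis by (simp add: trunc_kernel_def signed_powr_def cong: if_cong)
    next
      case False
      then have "eventually (\<lambda>n. r n < \<bar>s\<bar>) sequentially" using order_tendstoD(2)[OF r(3)] by simp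
      then have "eventually (\<lambda>n. trunc_kernel \<alpha> (r n) s = signed_powr (-\<alpha>) s) sequentially"
        by eventually_elim (simp add: trunc_kernel_def)
      then show ?thesis by (rule tendsto_eventually)
    qed
    then show "AE s in lborel. (\<lambda>n. trunc_kernel \<alpha> (r n) s * (w (z + s) - w z - (w (0 + s) - w 0)))
       \<longlonglongrightarrow> signed_powr (-\<alpha>) s * (w (z + s) - w z - (w (0 + s) - w 0))"
      by (intro AE_I2 tendsto_mult_right)
  qed (auto simp: trunc_kernel_def)
  moreover have "(\<lambda>n. trunc_drift \<alpha> w (r n) z - ?T n) \<longlonglongrightarrow> 0"
  proof (rule Lim_null_comparison)
    show "\<forall>\<^sub>F n in sequentially. norm (trunc_drift \<alpha> w (r n) z - ?T n) \<le> 4 * M * r n"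
      using trunc_drift_approx[OF r(1,2)] by simp
    show "(\<lambda>n. 4 * M * r n) \<longlonglongrightarrow> 0" using r(3) by (rule tendsto_mult_right_zero)
  qed
  ultimately show ?thesis using tendsto_add[of "\<lambda>n. trunc_drift \<alpha> w (r n) z - ?T n" 0 sequentially ?T] by simp
qed

lemma trunc_product_measurable [measurable]:
  "(\<lambda>(z, y). trunc_product \<alpha> w r z y) \<in> borel_measurable (borel \<Otimes>\<^sub>M borel)"
  unfolding trunc_product_def by measurable

lemma trunc_product_eq: "(LINT y|lborel. trunc_product \<alpha> w r z y)
   = (if r < \<bar>z\<bar> then signed_powr (-(2+\<alpha>)) z * w z * trunc_drift \<alpha> w r z else 0)"
proof (cases "r < \<bar>z\<bar>")
  case True
  have "(LINT y|lborel. trunc_product \<alpha> w r z y) = (LINT y|lborel. signed_powr (-(2+\<alpha>)) z * w z * 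
     (if r < \<bar>y\<bar> \<and> r < \<bar>y - z\<bar> then w y * (signed_powr (-\<alpha>) (y - z) - signed_powr (-\<alpha>) y) else 0))"
    using True by (intro Bochner_Integration.integral_cong) (auto simp: trunc_product_def)
  then show ?thesis using True by (simp add: trunc_drift_def)
qed (simp add: trunc_product_def)

lemma integrable_trunc_product:
  assumes r: "0 < r" "r \<le> 1"
  shows "integrable (lborel \<Otimes>\<^sub>M lborel) (\<lambda>(z, y). trunc_product \<alpha> w r z y)"
proof (rule lborel_pair.Fubini_integrable)
  \<comment> \<open>\<open>trunc_kernel\<close> with parameter 2+\<alpha> is the truncation of a(z),
    so both one-variable factors of the majorant are integrable by the same lemma.\<close>
  let ?k = "trunc_kernel \<alpha> r" and ?a = "\<lambda>z. trunc_kernel (2 + \<alpha>) r z"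
  have ki: "integrable lborel (\<lambda>s. \<bar>?k s\<bar>)" using integrable_trunc_kernel[OF r \<alpha>(1)] by simp
  have ki': "integrable lborel (\<lambda>y. \<bar>?k (y - z)\<bar>)" for z
    using lborel_integrable_real_affine[OF ki, of 1 "-z"] by simp
  have kI': "(LINT y|lborel. \<bar>?k (y - z)\<bar>) = (LINT y|lborel. \<bar>?k y\<bar>)" for z
    by (subst lborel_integral_real_affine[where c=1 and t=z]) auto
  have ai: "integrable lborel (\<lambda>z. \<bar>?a z\<bar>)"
    using integrable_trunc_kernel[OF r, of "2 + \<alpha>"] \<alpha> by simp
  have wM: "\<bar>w x\<bar> \<le> M" for x using C1_holder_boundD(2)[OF w] .
  have bd: "\<bar>trunc_product \<alpha> w r z y\<bar> \<le> \<bar>?a z\<bar> * (M * (M * (\<bar>?k (y - z)\<bar> + \<bar>?k y\<bar>)))" for z y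
  proof (cases "r < \<bar>z\<bar> \<and> r < \<bar>y\<bar> \<and> r < \<bar>y - z\<bar>")
    case True
    then have "trunc_product \<alpha> w r z y = ?a z * (w z * (w y * (?k (y - z) - ?k y)))"
      by (simp add: trunc_product_def trunc_kernel_def)
    also have "\<bar>\<dots>\<bar> \<le> \<bar>?a z\<bar> * (M * (M * (\<bar>?k (y - z)\<bar> + \<bar>?k y\<bar>)))"
      unfolding abs_mult using wM profile_bound_nonneg by (intro mult_left_mono mult_mono) auto
    finally show ?thesis .
  qed (auto simp: trunc_product_def profile_bound_nonneg)
  have bi: "integrable lborel (\<lambda>y. \<bar>?a z\<bar> * (M * (M * (\<bar>?k (y - z)\<bar> + \<bar>?k y\<bar>))))" for z
    using ki ki' by (intro integrable_mult_right Bochner_Integration.integrable_add)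
  have in1: "integrable lborel (\<lambda>y. trunc_product \<alpha> w r z y)" for z
    by (rule Bochner_Integration.integrable_bound[OF bi])
       (use bd in \<open>auto intro!: order_trans[OF _ abs_ge_self]\<close>)
  then show "AE z in lborel. integrable lborel (\<lambda>y. case (z, y) of (z, y) \<Rightarrow> trunc_product \<alpha> w r z y)" by simp
  show "integrable lborel (\<lambda>z. LINT y|lborel. norm (case (z, y) of (z, y) \<Rightarrow> trunc_product \<alpha> w r z y))"
  proof (rule Bochner_Integration.integrable_bound[OF integrable_mult_left[OF ai, of "M * (M * (2 * (LINT y|lborel. \<bar>?k y\<bar>)))"]])
    show "AE z in lborel. norm (LINT y|lborel. norm (case (z, y) of (z, y) \<Rightarrow> trunc_product \<alpha> w r z y))
      \<le> norm (\<bar>?a z\<bar> * (M * (M * (2 * (LINT y|lborel. \<bar>?k y\<bar>)))))"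
    proof (intro AE_I2)
      fix z
      have "(LINT y|lborel. \<bar>trunc_product \<alpha> w r z y\<bar>) \<le> (LINT y|lborel. \<bar>?a z\<bar> * (M * (M * (\<bar>?k (y - z)\<bar> + \<bar>?k y\<bar>))))"
        by (intro integral_mono integrable_abs in1 bi bd)
      also have "\<dots> = \<bar>?a z\<bar> * (M * (M * (2 * (LINT y|lborel. \<bar>?k y\<bar>))))"
        using ki ki' kI' by simp
      finally show "norm (LINT y|lborel. norm (case (z, y) of (z, y) \<Rightarrow> trunc_product \<alpha> w r z y))
          \<le> norm (\<bar>?a z\<bar> * (M * (M * (2 * (LINT y|lborel. \<bar>?k y\<bar>)))))"
        by (simp add: abs_mult profile_bound_nonneg)
    qed
  qed measurable
qed measurable

lemma trunc_product_lower_bound: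
  assumes r: "0 < r"
  shows "(if r < \<bar>z\<bar> \<and> r < \<bar>y\<bar> \<and> r < \<bar>y - z\<bar>
     then (w z * \<bar>z\<bar> powr (-1-\<alpha>)) * (w y * \<bar>y\<bar> powr (-1-\<alpha>)) else 0)
    \<le> trunc_product \<alpha> w r z y + trunc_product \<alpha> w r y z"
proof (cases "r < \<bar>z\<bar> \<and> r < \<bar>y\<bar> \<and> r < \<bar>y - z\<bar>")
  case True
  let ?a = "signed_powr (-(2+\<alpha>))" and ?k = "signed_powr (-\<alpha>)"
  have sw: "r < \<bar>z - y\<bar>" using True by (simp add: abs_minus_commute)
  have k: "?k (z - y) = - ?k (y - z)" using signed_powr_minus[of "-\<alpha>" "y - z"] by simp
  have "(w z * w y) * (\<bar>z\<bar> powr (-1-\<alpha>) * \<bar>y\<bar> powr (-1-\<alpha>))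
      \<le> (w z * w y) * ((?a z - ?a y) * ?k (y - z) - ?a z * ?k y - ?a y * ?k z)"
    using True r \<alpha> nonneg by (intro mult_left_mono kernel_symmetrized_lower_bound) auto
  also have "\<dots> = trunc_product \<alpha> w r z y + trunc_product \<alpha> w r y z"
    using True sw unfolding trunc_product_def k by (simp add: algebra_simps)
  finally show ?thesis using True by (simp add: mult_ac)
qed (auto simp: trunc_product_def abs_minus_commute)

lemma drift_measurable [measurable]: "drift \<alpha> w \<in> borel_measurable borel"
  unfolding drift_def by measurable

text \<open>The factor |z| won from the drift lowers the singularity of a(z) by one, back to that of
  the weight.\<close>

lemma abs_profile_drift_le:
  "\<bar>signed_powr (-(2+\<alpha>)) z * w z * drift \<alpha> w z\<bar>
    \<le> (w z * \<bar>z\<bar> powr (-1-\<alpha>)) * (2 * M * (LINT s|lborel. two_powr (\<theta> - \<alpha>) (-\<alpha>) s))"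
proof -
  have z: "\<bar>z\<bar> powr (-(2+\<alpha>)) * \<bar>z\<bar> = \<bar>z\<bar> powr (-1-\<alpha>)"
  proof (cases "z = 0")
    case False
    have "\<bar>z\<bar> powr (-(2+\<alpha>)) * \<bar>z\<bar> powr 1 = \<bar>z\<bar> powr (-1-\<alpha>)"
      by (simp only: powr_add[symmetric]) simp
    then show ?thesis by simp
  qed simp
  have "\<bar>signed_powr (-(2+\<alpha>)) z * w z * drift \<alpha> w z\<bar> \<le> \<bar>z\<bar> powr (-(2+\<alpha>)) * w z * (\<bar>z\<bar> * (2 * M * (LINT s|lborel. two_powr (\<theta> - \<alpha>) (-\<alpha>) s)))"
    unfolding abs_mult abs_signed_powr abs_of_nonneg[OF nonneg] drift_def
    using nonneg by (intro mult_left_mono abs_drift_integral_le) auto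
  also have "\<dots> = (\<bar>z\<bar> powr (-(2+\<alpha>)) * \<bar>z\<bar>) * w z * (2 * M * (LINT s|lborel. two_powr (\<theta> - \<alpha>) (-\<alpha>) s))"
    by (simp only: mult_ac)
  also have "\<dots> = (w z * \<bar>z\<bar> powr (-1-\<alpha>)) * (2 * M * (LINT s|lborel. two_powr (\<theta> - \<alpha>) (-\<alpha>) s))"
    unfolding z by (simp only: mult_ac)
  finally show ?thesis .
qed

lemma integrable_profile_drift: "integrable lborel (\<lambda>z. signed_powr (-(2+\<alpha>)) z * w z * drift \<alpha> w z)"
  by (rule Bochner_Integration.integrable_bound[OF integrable_mult_left[OF integrable_profile_weight]])
     (use abs_profile_drift_le in \<open>auto intro!: order_trans[OF _ abs_ge_self]\<close>)

text \<open>For each r, exchanging the variables by Fubini and averaging gives the pointwise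
  symmetrized bound under the integral. Then r tends to 0 on both sides by dominated convergence,
  with majorants multiples of \<psi>(z).\<close>

lemma quadratic_lower_bound:
  "(LINT z|lborel. w z * \<bar>z\<bar> powr (-1-\<alpha>))\<^sup>2
     \<le> 2 * (LINT z|lborel. signed_powr (-(2+\<alpha>)) z * w z * drift \<alpha> w z)"
proof -
  define r where "r = (\<lambda>n. inverse (real (Suc n)))"
  have r: "0 < r n" "r n \<le> 1" for n by (auto simp: r_def inverse_le_1_iff)
  have r0: "r \<longlonglongrightarrow> 0" unfolding r_def by (rule LIMSEQ_inverse_real_of_nat)
  define \<psi> where "\<psi> = (\<lambda>z. w z * \<bar>z\<bar> powr (-1-\<alpha>))"
  have \<psi>i: "integrable lborel \<psi>" unfolding \<psi>_def by (rule integrable_profile_weight)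
  have \<psi>0: "0 \<le> \<psi> z" for z unfolding \<psi>_def using nonneg by simp
  have [measurable]: "\<psi> \<in> borel_measurable borel" unfolding \<psi>_def by measurable
  define C where "C = 2 * M * (LINT s|lborel. two_powr (\<theta> - \<alpha>) (-\<alpha>) s) + 4 * M"
  define I where "I = (\<lambda>n. LINT z|lborel. LINT y|lborel. trunc_product \<alpha> w (r n) z y)"
  \<comment> \<open>The product whose full integral is the square, cut to the region on which the
    kernel inequality is available.\<close>
  define P where "P = (\<lambda>n z y. if r n < \<bar>z\<bar> \<and> r n < \<bar>y\<bar> \<and> r n < \<bar>y - z\<bar> then \<psi> z * \<psi> y else 0)"
  have ev: "eventually (\<lambda>n. r n < \<bar>x\<bar>) sequentially" if "x \<noteq> 0" for x
    using order_tendstoD(2)[OF r0, of "\<bar>x\<bar>"] that by simp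
  have lim1: "I \<longlonglongrightarrow> (LINT z|lborel. signed_powr (-(2+\<alpha>)) z * w z * drift \<alpha> w z)"
    unfolding I_def trunc_product_eq
  proof (rule integral_dominated_convergence[where w="\<lambda>z. \<psi> z * C"])
    show "integrable lborel (\<lambda>z. \<psi> z * C)" using \<psi>i by simp
    show "AE z in lborel. (\<lambda>n. if r n < \<bar>z\<bar> then signed_powr (-(2+\<alpha>)) z * w z * trunc_drift \<alpha> w (r n) z else 0)
       \<longlonglongrightarrow> signed_powr (-(2+\<alpha>)) z * w z * drift \<alpha> w z"
    proof (intro AE_I2)
      fix z :: real
      show "(\<lambda>n. if r n < \<bar>z\<bar> then signed_powr (-(2+\<alpha>)) z * w z * trunc_drift \<alpha> w (r n) z else 0)
       \<longlonglongrightarrow> signed_powr (-(2+\<alpha>)) z * w z * drift \<alpha> w z"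
      proof (cases "z = 0")
        case False
        have "(\<lambda>n. signed_powr (-(2+\<alpha>)) z * w z * trunc_drift \<alpha> w (r n) z) \<longlonglongrightarrow> signed_powr (-(2+\<alpha>)) z * w z * drift \<alpha> w z"
          by (intro tendsto_mult_left trunc_drift_tendsto r r0)
        then show ?thesis
          by (rule Lim_transform_eventually) (use ev[OF False] in \<open>auto elim!: eventually_mono\<close>)
      qed (simp add: w0 cong: if_cong)
    qed
    show "AE z in lborel. norm (if r n < \<bar>z\<bar> then signed_powr (-(2+\<alpha>)) z * w z * trunc_drift \<alpha> w (r n) z else 0) \<le> \<psi> z * C" for n
    proof (intro AE_I2)
      fix z
      show "norm (if r n < \<bar>z\<bar> then signed_powr (-(2+\<alpha>)) z * w z * trunc_drift \<alpha> w (r n) z else 0) \<le> \<psi> z * C"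
      proof (cases "r n < \<bar>z\<bar>")
        case True
        then have z: "z \<noteq> 0" using r[of n] by auto
        have "\<bar>signed_powr (-(2+\<alpha>)) z * w z * trunc_drift \<alpha> w (r n) z\<bar> \<le> \<bar>z\<bar> powr (-(2+\<alpha>)) * w z * (\<bar>z\<bar> * C)"
          unfolding abs_mult abs_signed_powr abs_of_nonneg[OF nonneg] C_def
          using nonneg by (intro mult_left_mono abs_trunc_drift_le r True) auto
        also have "\<dots> = (\<bar>z\<bar> powr (-(2+\<alpha>)) * \<bar>z\<bar> powr 1) * w z * C"
          using z by (simp add: mult_ac)
        also have "\<dots> = \<psi> z * C"
          unfolding powr_add[symmetric] \<psi>_def by (simp add: mult_ac)
        finally show ?thesis using True by simp
      qed (simp add: \<psi>0 C_def add_nonneg_nonneg drift_bound_const_nonneg profile_bound_nonneg)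
    qed
  qed (unfold trunc_drift_def, measurable)
  have P0: "\<bar>P n z y\<bar> \<le> \<psi> z * \<psi> y" for n z y using \<psi>0 by (auto simp: P_def)
  have [measurable]: "(\<lambda>(z, y). P n z y) \<in> borel_measurable (borel \<Otimes>\<^sub>M borel)" for n
    unfolding P_def by measurable
  have Pi: "integrable lborel (P n z)" for n z
    by (rule Bochner_Integration.integrable_bound[OF integrable_mult_right[OF \<psi>i, of "\<psi> z"]])
       (use P0 in \<open>auto intro!: order_trans[OF _ abs_ge_self]\<close>)
  have P_le: "\<bar>LINT y|lborel. P n z y\<bar> \<le> \<psi> z * (LINT y|lborel. \<psi> y)" for n z
    using integral_abs_bound_integral[OF Pi integrable_mult_right[OF \<psi>i] P0, of n z] by simp
  have Pii: "integrable lborel (\<lambda>z. LINT y|lborel. P n z y)" for n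
    by (rule Bochner_Integration.integrable_bound[OF integrable_mult_left[OF \<psi>i, of "LINT y|lborel. \<psi> y"]])
       (use P_le in \<open>auto intro!: order_trans[OF _ abs_ge_self]\<close>)
  have lim2: "(\<lambda>n. LINT z|lborel. LINT y|lborel. P n z y) \<longlonglongrightarrow> (LINT z|lborel. \<psi> z * (LINT y|lborel. \<psi> y))"
  proof (rule integral_dominated_convergence[where w="\<lambda>z. \<psi> z * (LINT y|lborel. \<psi> y)"])
    have "(\<lambda>n. LINT y|lborel. P n z y) \<longlonglongrightarrow> (LINT y|lborel. \<psi> z * \<psi> y)" for z
    proof (rule integral_dominated_convergence[where w="\<lambda>y. \<psi> z * \<psi> y"])
      \<comment> \<open>In the limit the region misses the diagonal, a null set for fixed z, and the
        axes, where \<psi> vanishes.\<close>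
      show "AE y in lborel. (\<lambda>n. P n z y) \<longlonglongrightarrow> \<psi> z * \<psi> y"
        using AE_lborel_singleton[of z]
      proof eventually_elim
        case (elim y)
        show ?case
        proof (cases "z = 0 \<or> y = 0")
          case True
          then have "\<psi> z * \<psi> y = 0" by (auto simp: \<psi>_def w0)
          then show ?thesis unfolding P_def by (simp only: if_cancel tendsto_const)
        next
          case False
          have "eventually (\<lambda>n. P n z y = \<psi> z * \<psi> y) sequentially"
          proof -
            have "z \<noteq> 0" "y \<noteq> 0" "y - z \<noteq> 0" using False elim by auto
            from this[THEN ev] show ?thesis by eventually_elim (simp add: P_def)
          qed
          then show ?thesis by (rule tendsto_eventually)
        qed
      qed
    qed (use P0 \<psi>i in \<open>auto\<close>)
    then show "AE z in lborel. (\<lambda>n. LINT y|lborel. P n z y) \<longlonglongrightarrow> \<psi> z * (LINT y|lborel. \<psi> y)" by simp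
  qed (use P_le \<psi>i in auto)
  have "(LINT z|lborel. LINT y|lborel. P n z y) \<le> 2 * I n" for n
  proof -
    let ?G = "trunc_product \<alpha> w (r n)"
    have G: "integrable (lborel \<Otimes>\<^sub>M lborel) (case_prod ?G)" by (rule integrable_trunc_product[OF r])
    have G': "integrable (lborel \<Otimes>\<^sub>M lborel) (\<lambda>(z, y). ?G y z)"
      using lborel_pair.integrable_product_swap[OF G] by (simp add: case_prod_beta')
    \<comment> \<open>The exchange of variables for which the truncation was introduced.\<close>
    have swap: "(LINT z|lborel. LINT y|lborel. ?G y z) = I n"
      unfolding I_def by (rule lborel_pair.Fubini_integral[OF G])
    have ae1: "AE z in lborel. integrable lborel (\<lambda>y. ?G z y)" by (rule lborel_pair.AE_integrable_fst[OF G])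
    have ae2: "AE z in lborel. integrable lborel (\<lambda>y. ?G y z)" by (rule lborel_pair.AE_integrable_fst[OF G'])
    have i1: "integrable lborel (\<lambda>z. LINT y|lborel. ?G z y)" by (rule lborel_pair.integrable_fst[OF G])
    have i2: "integrable lborel (\<lambda>z. LINT y|lborel. ?G y z)" by (rule lborel_pair.integrable_fst[OF G'])
    have "(LINT z|lborel. LINT y|lborel. P n z y) \<le> (LINT z|lborel. (LINT y|lborel. ?G z y) + (LINT y|lborel. ?G y z))"
    proof (rule integral_mono_AE[OF Pii Bochner_Integration.integrable_add[OF i1 i2]])
      show "AE z in lborel. (LINT y|lborel. P n z y) \<le> (LINT y|lborel. ?G z y) + (LINT y|lborel. ?G y z)"
        using ae1 ae2
      proof eventually_elim
        case (elim z)
        have "(LINT y|lborel. P n z y) \<le> (LINT y|lborel. ?G z y + ?G y z)"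
        proof (rule integral_mono[OF Pi Bochner_Integration.integrable_add[OF elim]])
          show "P n z y \<le> ?G z y + ?G y z" for y
            using trunc_product_lower_bound[OF r(1)[of n], of z y] unfolding P_def \<psi>_def .
        qed
        then show ?case using elim by simp
      qed
    qed
    also have "\<dots> = I n + I n"
      unfolding Bochner_Integration.integral_add[OF i1 i2] swap by (simp add: I_def)
    finally show ?thesis by simp
  qed
  then have "(LINT z|lborel. \<psi> z * (LINT y|lborel. \<psi> y)) \<le> 2 * (LINT z|lborel. signed_powr (-(2+\<alpha>)) z * w z * drift \<alpha> w z)"
    using LIMSEQ_le[OF lim2 tendsto_mult_left[OF lim1, of 2]] by blast
  then show ?thesis by (simp add: power2_eq_square \<psi>_def)
qed

end

section \<open>Ordinary differential equations\<close>

lemma nondecreasing_of_deriv_within: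
  fixes f :: "real \<Rightarrow> real"
  assumes d: "\<And>t. t \<in> {a..b} \<Longrightarrow> (f has_real_derivative f' t) (at t within {a..b})"
    and n: "\<And>t. t \<in> {a..b} \<Longrightarrow> 0 \<le> f' t" and st: "a \<le> s" "s \<le> t" "t \<le> b"
  shows "f s \<le> f t"
proof -
  have "\<exists>x\<in>{s..t}. f t - f s = (\<lambda>h. f' x * h) (t - s)"
  proof (rule mvt_very_simple[OF st(2)])
    fix x assume "s \<le> x" "x \<le> t"
    then have "(f has_real_derivative f' x) (at x within {s..t})"
      using st by (intro DERIV_subset[OF d]) auto
    then show "(f has_derivative (\<lambda>h. f' x * h)) (at x within {s..t})"
      by (simp add: has_field_derivative_def)
  qed
  then obtain x where x: "x \<in> {s..t}" "f t - f s = f' x * (t - s)" by auto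
  have "0 \<le> f' x * (t - s)" using n[of x] x st by (intro mult_nonneg_nonneg) auto
  then show ?thesis using x by simp
qed

text \<open>A Gronwall argument in both time directions: g^2 exp(2 L t) is nondecreasing and g^2
  exp(-2 L t) is nonincreasing, so a zero spreads to earlier and to later times.\<close>

lemma zero_of_deriv_le_abs:
  fixes g :: "real \<Rightarrow> real"
  assumes d: "\<And>t. t \<in> {a..b} \<Longrightarrow> (g has_real_derivative g' t) (at t within {a..b})"
    and b: "\<And>t. t \<in> {a..b} \<Longrightarrow> \<bar>g' t\<bar> \<le> L * \<bar>g t\<bar>"
    and t0: "t0 \<in> {a..b}" "g t0 = 0" and t1: "t1 \<in> {a..b}"
  shows "g t1 = 0"
proof -
  have gg: "\<bar>2 * (g t * g' t)\<bar> \<le> 2 * L * (g t)\<^sup>2" if "t \<in> {a..b}" for t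
    using mult_left_mono[OF b[OF that], of "2 * \<bar>g t\<bar>"]
    by (simp add: abs_mult power2_eq_square mult_ac)
  have D: "((\<lambda>t. (g t)\<^sup>2 * exp (c * t)) has_real_derivative (2 * (g t * g' t) + c * (g t)\<^sup>2) * exp (c * t)) (at t within {a..b})"
    if "t \<in> {a..b}" for t c
    by (rule derivative_eq_intros d[OF that] refl)+ (simp add: algebra_simps)
  have m: "(g s)\<^sup>2 * exp (2 * L * s) \<le> (g t)\<^sup>2 * exp (2 * L * t)" if "a \<le> s" "s \<le> t" "t \<le> b" for s t
  proof (rule nondecreasing_of_deriv_within[OF D[where c="2 * L"] _ that])
    fix t assume "t \<in> {a..b}"
    from gg[OF this] show "0 \<le> (2 * (g t * g' t) + 2 * L * (g t)\<^sup>2) * exp (2 * L * t)"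
      by (intro mult_nonneg_nonneg) (linarith, simp)
  qed
  have m': "- ((g s)\<^sup>2 * exp (- 2 * L * s)) \<le> - ((g t)\<^sup>2 * exp (- 2 * L * t))" if "a \<le> s" "s \<le> t" "t \<le> b" for s t
  proof (rule nondecreasing_of_deriv_within[OF DERIV_minus[OF D[where c="- 2 * L"]] _ that])
    fix t assume "t \<in> {a..b}"
    from gg[OF this] have "0 \<le> - (2 * (g t * g' t) + - 2 * L * (g t)\<^sup>2)" by simp
    then have "0 \<le> - (2 * (g t * g' t) + - 2 * L * (g t)\<^sup>2) * exp (- 2 * L * t)"
      by (rule mult_nonneg_nonneg) simp
    then show "0 \<le> - ((2 * (g t * g' t) + - 2 * L * (g t)\<^sup>2) * exp (- 2 * L * t))" by (simp only: mult_minus_left)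
  qed
  consider "t1 \<le> t0" | "t0 \<le> t1" by linarith
  then have "(g t1)\<^sup>2 \<le> 0"
  proof cases
    case 1
    then show ?thesis using m[of t1 t0] t0 t1 by (auto simp: mult_le_0_iff)
  next
    case 2
    then show ?thesis using m'[of t0 t1] t0 t1 by (auto simp: mult_le_0_iff)
  qed
  then show ?thesis by simp
qed

text \<open>The function -1/J(t) - c t is nondecreasing, while -1/J stays negative; comparing times
  0 and S bounds S.\<close>

lemma riccati_blowup_time:
  fixes J :: "real \<Rightarrow> real"
  assumes "0 \<le> S" "0 < J 0" "0 \<le> c"
    and d: "\<And>t. t \<in> {0..S} \<Longrightarrow> (J has_real_derivative J' t) (at t within {0..S})"
    and le: "\<And>t. t \<in> {0..S} \<Longrightarrow> c * (J t)\<^sup>2 \<le> J' t"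
  shows "c * S * J 0 \<le> 1"
proof -
  have "0 \<le> c * (J t)\<^sup>2" for t using assms by simp
  then have J'0: "0 \<le> J' t" if "t \<in> {0..S}" for t using le[OF that] order_trans by blast
  have mono: "J 0 \<le> J t" if "t \<in> {0..S}" for t
    by (rule nondecreasing_of_deriv_within[OF d J'0]) (use that in auto)
  then have pos: "0 < J t" if "t \<in> {0..S}" for t using assms(2) that less_le_trans by blast
  have "- inverse (J 0) - c * 0 \<le> - inverse (J S) - c * S"
  proof (rule nondecreasing_of_deriv_within[where a=0 and b=S and f="\<lambda>t. - inverse (J t) - c * t"
        and f'="\<lambda>t. inverse (J t) * J' t * inverse (J t) - c"])
    show "((\<lambda>t. - inverse (J t) - c * t) has_real_derivative (inverse (J t) * J' t * inverse (J t) - c)) (at t within {0..S})"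
      if "t \<in> {0..S}" for t
      by (rule derivative_eq_intros d[OF that] refl)+ (use pos[OF that] in auto)
    show "0 \<le> inverse (J t) * J' t * inverse (J t) - c" if "t \<in> {0..S}" for t
    proof -
      have "c = inverse (J t) * (c * (J t)\<^sup>2) * inverse (J t)"
        using pos[OF that] by (simp add: power2_eq_square)
      also have "\<dots> \<le> inverse (J t) * J' t * inverse (J t)"
        using pos[OF that] le[OF that] by (intro mult_right_mono mult_left_mono) auto
      finally show ?thesis by simp
    qed
  qed (use assms in auto)
  moreover have "0 \<le> inverse (J S)" using pos[of S] assms by simp
  ultimately have "c * S \<le> inverse (J 0)" by linarith
  then have "c * S * J 0 \<le> inverse (J 0) * J 0" using assms by (intro mult_right_mono) auto
  then show ?thesis using assms by simp
qed

text \<open>Replaces the product rule when v is only Lipschitz. The difference quotient of f v, less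
  v(y) times that of f, equals f(x) times the difference quotient of v, which L bounds; the limit
  inherits the bound.\<close>

lemma deriv_of_product_lipschitz_bound:
  fixes f v :: "real \<Rightarrow> real"
  assumes f: "(f has_real_derivative f') (at x)"
    and v: "\<And>y. \<bar>v y - v x\<bar> \<le> L * \<bar>y - x\<bar>"
    and D: "((\<lambda>y. f y * v y) has_real_derivative D) (at x)"
  shows "\<bar>D - v x * f'\<bar> \<le> L * \<bar>f x\<bar>"
proof -
  have "((\<lambda>y. v y - v x) \<longlongrightarrow> 0) (at x)"
  proof (rule Lim_null_comparison[of _ "\<lambda>y. L * \<bar>y - x\<bar>"])
    show "\<forall>\<^sub>F y in at x. norm (v y - v x) \<le> L * \<bar>y - x\<bar>" using v by simp
    show "((\<lambda>y. L * \<bar>y - x\<bar>) \<longlongrightarrow> 0) (at x)" by (auto intro!: tendsto_eq_intros)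
  qed
  then have vl: "(v \<longlongrightarrow> v x) (at x)" by (simp add: LIM_zero_iff)
  have "((\<lambda>y. \<bar>(f y * v y - f x * v x) / (y - x) - v y * ((f y - f x) / (y - x))\<bar>) \<longlongrightarrow> \<bar>D - v x * f'\<bar>) (at x)"
    using f D vl by (intro tendsto_intros) (auto simp: has_field_derivative_iff)
  then show ?thesis
  proof (rule tendsto_upperbound)
    have "\<bar>(f y * v y - f x * v x) / (y - x) - v y * ((f y - f x) / (y - x))\<bar> \<le> L * \<bar>f x\<bar>" if "y \<noteq> x" for y
    proof -
      have "(f y * v y - f x * v x) / (y - x) - v y * ((f y - f x) / (y - x)) = f x * ((v y - v x) / (y - x))"
        by (simp add: diff_divide_distrib[symmetric] algebra_simps)
      also have "\<bar>\<dots>\<bar> = \<bar>f x\<bar> * (\<bar>v y - v x\<bar> / \<bar>y - x\<bar>)" by (simp add: abs_mult)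
      also have "\<dots> \<le> \<bar>f x\<bar> * L"
        using v[of y] that by (intro mult_left_mono) (auto simp: divide_le_eq)
      finally show ?thesis by (simp add: mult.commute)
    qed
    then show "\<forall>\<^sub>F y in at x. \<bar>(f y * v y - f x * v x) / (y - x) - v y * ((f y - f x) / (y - x))\<bar> \<le> L * \<bar>f x\<bar>"
      by (auto simp: eventually_at_filter)
  qed simp
qed

lemma continuous_on_lipschitz_compose:
  fixes v :: "real \<Rightarrow> real \<Rightarrow> real"
  assumes c: "\<And>x. continuous_on A (\<lambda>t. v t x)"
    and l: "\<And>t x y. t \<in> A \<Longrightarrow> \<bar>v t x - v t y\<bar> \<le> L * \<bar>x - y\<bar>"
    and X: "continuous_on A X"
  shows "continuous_on A (\<lambda>t. v t (X t))"
  unfolding continuous_on_def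
proof
  fix t assume t: "t \<in> A"
  have X': "(X \<longlongrightarrow> X t) (at t within A)" using X t by (auto simp: continuous_on_def)
  have 1: "((\<lambda>s. v s (X t)) \<longlongrightarrow> v t (X t)) (at t within A)" using c t by (auto simp: continuous_on_def)
  have "((\<lambda>s. v s (X s) - v s (X t)) \<longlongrightarrow> 0) (at t within A)"
  proof (rule Lim_null_comparison[of _ "\<lambda>s. L * \<bar>X s - X t\<bar>"])
    show "\<forall>\<^sub>F s in at t within A. norm (v s (X s) - v s (X t)) \<le> L * \<bar>X s - X t\<bar>"
      using l by (auto simp: eventually_at_filter)
    show "((\<lambda>s. L * \<bar>X s - X t\<bar>) \<longlongrightarrow> 0) (at t within A)"
      using X' by (auto intro!: tendsto_eq_intros)
  qed
  from tendsto_add[OF this 1] show "((\<lambda>s. v s (X s)) \<longlongrightarrow> v t (X t)) (at t within A)" by simp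
qed

primrec picard :: "(real \<Rightarrow> real \<Rightarrow> real) \<Rightarrow> real \<Rightarrow> real \<Rightarrow> nat \<Rightarrow> real \<Rightarrow> real" where
  "picard v a x0 0 = (\<lambda>t. x0)"
| "picard v a x0 (Suc n) = (\<lambda>t. x0 + integral {a..t} (\<lambda>s. v s (picard v a x0 n s)))"

text \<open>The global Lipschitz bound gives factorial decay of successive iterates, so the
  iteration converges uniformly on all of [a,b], however long. The sup bound \<open>B\<close> starts
  the induction.\<close>

lemma picard_lindelof:
  fixes v :: "real \<Rightarrow> real \<Rightarrow> real"
  assumes ab: "a \<le> b" and L: "0 \<le> L"
    and c: "\<And>x. continuous_on {a..b} (\<lambda>t. v t x)"
    and l: "\<And>t x y. t \<in> {a..b} \<Longrightarrow> \<bar>v t x - v t y\<bar> \<le> L * \<bar>x - y\<bar>"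
    and B: "\<And>t x. t \<in> {a..b} \<Longrightarrow> \<bar>v t x\<bar> \<le> B"
  obtains X where "X a = x0" "\<And>t. t \<in> {a..b} \<Longrightarrow> (X has_real_derivative v t (X t)) (at t within {a..b})"
proof -
  let ?P = "picard v a x0"
  have vc: "continuous_on {a..b} (\<lambda>t. v t (X t))" if "continuous_on {a..b} X" for X
    by (rule continuous_on_lipschitz_compose[OF c _ that]) (rule l)
  have B0: "0 \<le> B" using B[of a 0] ab by simp
  have Pc: "continuous_on {a..b} (?P n)" for n
  proof (induction n)
    case (Suc n)
    show ?case
      by (auto intro!: continuous_intros indefinite_integral_continuous_1 integrable_continuous_interval vc Suc)
  qed simp
  have vi: "(\<lambda>s. v s (X s)) integrable_on {a..t}" if "continuous_on {a..b} X" "t \<in> {a..b}" for X t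
    by (rule integrable_continuous_interval) (rule continuous_on_subset[OF vc[OF that(1)]], use that in auto)
  have pw: "((\<lambda>s. C * (s - a) ^ n) has_integral C * (t - a) ^ Suc n / real (Suc n)) {a..t}" if "a \<le> t" for C t n
  proof -
    have "((\<lambda>s. C * (s - a) ^ n) has_integral C * (t - a) ^ Suc n / real (Suc n) - C * (a - a) ^ Suc n / real (Suc n)) {a..t}"
    proof (rule fundamental_theorem_of_calculus[OF that])
      fix x
      have "((\<lambda>s. C * (s - a) ^ Suc n / real (Suc n)) has_real_derivative C * (real (Suc n) * (x - a) ^ n) / real (Suc n)) (at x within {a..t})"
        by (rule derivative_eq_intros refl | simp)+
      then show "((\<lambda>s. C * (s - a) ^ Suc n / real (Suc n)) has_vector_derivative C * (x - a) ^ n) (at x within {a..t})"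
        by (simp add: has_real_derivative_iff_has_vector_derivative[symmetric] del: of_nat_Suc)
    qed
    then show ?thesis by simp
  qed
  have step: "\<bar>?P (Suc n) t - ?P n t\<bar> \<le> B * L ^ n / fact (Suc n) * (t - a) ^ Suc n" if "t \<in> {a..b}" for n t
    using that
  proof (induction n arbitrary: t)
    case 0
    have "norm (integral {a..t} (\<lambda>s. v s x0)) \<le> integral {a..t} (\<lambda>s. B * (s - a) ^ 0)"
      using 0 by (intro integral_norm_bound_integral vi has_integral_integrable[OF pw]) (auto intro: B)
    also have "\<dots> = B * (t - a)" using integral_unique[OF pw[of t B 0]] 0 by simp
    finally show ?case by simp
  next
    case (Suc n)
    let ?C = "L * (B * L ^ n / fact (Suc n))"
    have "?P (Suc (Suc n)) t - ?P (Suc n) t = integral {a..t} (\<lambda>s. v s (?P (Suc n) s)) - integral {a..t} (\<lambda>s. v s (?P n s))"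
      by simp
    also have "\<dots> = integral {a..t} (\<lambda>s. v s (?P (Suc n) s) - v s (?P n s))"
      by (rule Henstock_Kurzweil_Integration.integral_diff[symmetric]) (intro vi Pc Suc.prems)+
    also have "norm \<dots> \<le> integral {a..t} (\<lambda>s. ?C * (s - a) ^ Suc n)"
    proof (intro integral_norm_bound_integral integrable_diff vi Pc Suc.prems has_integral_integrable[OF pw])
      fix s assume "s \<in> {a..t}"
      then have s: "s \<in> {a..b}" using Suc.prems by auto
      have "norm (v s (?P (Suc n) s) - v s (?P n s)) \<le> L * \<bar>?P (Suc n) s - ?P n s\<bar>" using l[OF s] by simp
      also have "\<dots> \<le> L * (B * L ^ n / fact (Suc n) * (s - a) ^ Suc n)"
        by (intro mult_left_mono Suc.IH s L)
      finally show "norm (v s (?P (Suc n) s) - v s (?P n s)) \<le> ?C * (s - a) ^ Suc n" by (simp only: mult.assoc)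
    qed (use Suc.prems in auto)
    also have "\<dots> = ?C * (t - a) ^ Suc (Suc n) / real (Suc (Suc n))"
      by (rule integral_unique[OF pw]) (use Suc.prems in auto)
    also have "\<dots> = B * L ^ Suc n / fact (Suc (Suc n)) * (t - a) ^ Suc (Suc n)"
      by (simp add: mult_ac)
    finally show ?case by simp
  qed
  define d where "d = (\<lambda>n t. ?P (Suc n) t - ?P n t)"
  define Y where "Y = (\<lambda>t. x0 + (\<Sum>n. d n t))"
  have unif: "uniform_limit {a..b} ?P Y sequentially"
  proof -
    have "uniform_limit {a..b} (\<lambda>n t. \<Sum>i<n. d i t) (\<lambda>t. \<Sum>i. d i t) sequentially"
    proof (rule Weierstrass_m_test)
      have "summable (\<lambda>n. B * (b - a) * (inverse (fact n) * (L * (b - a)) ^ n))"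
        by (intro summable_mult summable_exp)
      moreover have "B * (b - a) * (inverse (fact n) * (L * (b - a)) ^ n) = B * L ^ n / fact n * (b - a) ^ Suc n" for n
        by (simp add: power_mult_distrib divide_inverse mult_ac)
      ultimately show "summable (\<lambda>n. B * L ^ n / fact n * (b - a) ^ Suc n)" by simp
      fix n t assume t: "t \<in> {a..b}"
      \<comment> \<open>Weakening the factorial by one index makes the majorant a multiple of the
        exponential series.\<close>
      have "B * L ^ n / fact (Suc n) * (t - a) ^ Suc n \<le> B * L ^ n / fact n * (b - a) ^ Suc n"
        using t B0 L by (intro mult_mono divide_left_mono power_mono fact_mono) auto
      then show "norm (d n t) \<le> B * L ^ n / fact n * (b - a) ^ Suc n"
        using step[OF t, of n] by (simp add: d_def del: picard.simps)
    qed
    then have "uniform_limit {a..b} (\<lambda>n t. x0 + (\<Sum>i<n. d i t)) Y sequentially"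
      unfolding Y_def by (intro uniform_limit_intros)
    moreover have "x0 + (\<Sum>i<n. d i t) = ?P n t" for n t
      unfolding d_def by (subst sum_lessThan_telescope) simp
    ultimately show ?thesis by simp
  qed
  have Yc: "continuous_on {a..b} Y"
    by (rule uniform_limit_theorem[OF _ unif]) (use Pc in auto)
  have Yeq: "Y t = x0 + integral {a..t} (\<lambda>s. v s (Y s))" if t: "t \<in> {a..b}" for t
  proof -
    have ul: "uniform_limit {a..t} (\<lambda>n s. v s (?P n s)) (\<lambda>s. v s (Y s)) sequentially"
    proof (rule uniform_limitI)
      fix e :: real assume e: "0 < e"
      \<comment> \<open>L may be 0, hence the division by L + 1.\<close>
      have "\<forall>\<^sub>F n in sequentially. \<forall>s\<in>{a..b}. dist (?P n s) (Y s) < e / (L + 1)"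
        using uniform_limitD[OF unif] e L by simp
      then show "\<forall>\<^sub>F n in sequentially. \<forall>s\<in>{a..t}. dist (v s (?P n s)) (v s (Y s)) < e"
      proof eventually_elim
        case (elim n)
        show ?case
        proof
          fix s assume "s \<in> {a..t}"
          then have s: "s \<in> {a..b}" using t by auto
          have "dist (v s (?P n s)) (v s (Y s)) \<le> L * \<bar>?P n s - Y s\<bar>"
            using l[OF s] by (simp add: dist_real_def)
          also have "\<dots> \<le> (L + 1) * \<bar>?P n s - Y s\<bar>" by (intro mult_right_mono) auto
          also have "\<dots> < e"
            using elim s L by (auto simp: dist_real_def field_simps)
          finally show "dist (v s (?P n s)) (v s (Y s)) < e" .
        qed
      qed
    qed
    have ct: "continuous_on {a..t} (\<lambda>s. v s (?P n s))" for n
      by (rule continuous_on_subset[OF vc[OF Pc]]) (use t in auto)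
    obtain I K where IK: "\<And>n. ((\<lambda>s. v s (?P n s)) has_integral I n) {a..t}"
        "((\<lambda>s. v s (Y s)) has_integral K) {a..t}" "I \<longlonglongrightarrow> K"
      using uniform_limit_integral[OF ul ct sequentially_bot] by blast
    then have "(\<lambda>n. integral {a..t} (\<lambda>s. v s (?P n s))) \<longlonglongrightarrow> integral {a..t} (\<lambda>s. v s (Y s))"
      using IK(1)[THEN integral_unique] IK(2)[THEN integral_unique] by simp
    from tendsto_add[OF tendsto_const this, of x0]
    have "(\<lambda>n. ?P (Suc n) t) \<longlonglongrightarrow> x0 + integral {a..t} (\<lambda>s. v s (Y s))" by simp
    moreover have "(\<lambda>n. ?P (Suc n) t) \<longlonglongrightarrow> Y t"
      by (rule LIMSEQ_Suc[OF tendsto_uniform_limitI[OF unif t]])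
    ultimately show ?thesis using LIMSEQ_unique by blast
  qed
  show ?thesis
  proof (rule that)
    show "Y a = x0" using Yeq[of a] ab by simp
    fix t assume t: "t \<in> {a..b}"
    have "((\<lambda>u. integral {a..u} (\<lambda>s. v s (Y s))) has_real_derivative v t (Y t)) (at t within {a..b})"
      unfolding has_real_derivative_iff_has_vector_derivative
      by (rule integral_has_vector_derivative[OF vc[OF Yc] t])
    then have "((\<lambda>u. x0 + integral {a..u} (\<lambda>s. v s (Y s))) has_real_derivative v t (Y t)) (at t within {a..b})"
      by (auto intro!: derivative_eq_intros)
    then show "(Y has_real_derivative v t (Y t)) (at t within {a..b})"
      by (rule has_field_derivative_transform_within[OF _ zero_less_one t]) (use Yeq in auto)
  qed
qed

text \<open>Time reversal t to a + b - t. It serves to trace a given point back to the initial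
  time.\<close>

lemma picard_lindelof_backward:
  fixes v :: "real \<Rightarrow> real \<Rightarrow> real"
  assumes ab: "a \<le> b" and L: "0 \<le> L"
    and c: "\<And>x. continuous_on {a..b} (\<lambda>t. v t x)"
    and l: "\<And>t x y. t \<in> {a..b} \<Longrightarrow> \<bar>v t x - v t y\<bar> \<le> L * \<bar>x - y\<bar>"
    and B: "\<And>t x. t \<in> {a..b} \<Longrightarrow> \<bar>v t x\<bar> \<le> B"
  obtains X where "X b = x1" "\<And>t. t \<in> {a..b} \<Longrightarrow> (X has_real_derivative v t (X t)) (at t within {a..b})"
proof -
  have im: "(\<lambda>t. a + b - t) ` {a..b} = {a..b}"
    by (auto simp: image_iff intro!: bexI[of _ "a + b - _"])
  obtain X where X: "X a = x1" "\<And>t. t \<in> {a..b} \<Longrightarrow> (X has_real_derivative - v (a + b - t) (X t)) (at t within {a..b})"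
  proof (rule picard_lindelof[of a b L "\<lambda>t x. - v (a + b - t) x" B x1])
    show "continuous_on {a..b} (\<lambda>t. - v (a + b - t) x)" for x
      by (intro continuous_on_minus continuous_on_compose2[OF c[of x], of "{a..b}" "\<lambda>t. a + b - t"])
         (auto simp: im intro!: continuous_intros)
    show "\<bar>- v (a + b - t) x - - v (a + b - t) y\<bar> \<le> L * \<bar>x - y\<bar>" if "t \<in> {a..b}" for t x y
      using l[of "a + b - t" y x] that by (simp add: abs_minus_commute)
    show "\<bar>- v (a + b - t) x\<bar> \<le> B" if "t \<in> {a..b}" for t x
      using B[of "a + b - t" x] that by simp
  qed (use ab L in auto)
  show ?thesis
  proof (rule that[of "\<lambda>t. X (a + b - t)"])
    show "X (a + b - b) = x1" using X by simp
    fix t assume t: "t \<in> {a..b}"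
    have "(X has_real_derivative - v t (X (a + b - t))) (at (a + b - t) within (\<lambda>t. a + b - t) ` {a..b})"
      using X(2)[of "a + b - t"] t unfolding im by auto
    moreover have "((\<lambda>t. a + b - t) has_real_derivative - 1) (at t within {a..b})"
      by (auto intro!: derivative_eq_intros)
    ultimately show "((\<lambda>t. X (a + b - t)) has_real_derivative v t (X (a + b - t))) (at t within {a..b})"
      using DERIV_image_chain[of X _ "\<lambda>t. a + b - t" t "{a..b}"] by (fastforce simp: o_def)
  qed
qed

section \<open>Growth of the weighted mass\<close>

lemma C1_holder_bound_deriv_continuous:
  assumes f: "C1_holder_bound \<theta> M f" and \<theta>: "0 < \<theta>"
  shows "continuous_on UNIV (deriv f)"
proof (intro continuous_at_imp_continuous_on ballI)
  fix x
  have "((\<lambda>y. deriv f y - deriv f x) \<longlongrightarrow> 0) (at x)"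
  proof (rule Lim_null_comparison)
    show "\<forall>\<^sub>F y in at x. norm (deriv f y - deriv f x) \<le> M * \<bar>y - x\<bar> powr \<theta>"
      using C1_holder_boundD(4)[OF f] by simp
    have "((\<lambda>y. \<bar>y - x\<bar>) \<longlongrightarrow> 0) (at x)" by (auto intro!: tendsto_eq_intros)
    then have "((\<lambda>y. \<bar>y - x\<bar> powr \<theta>) \<longlongrightarrow> 0) (at x)"
      by (rule tendsto_zero_powrI[OF _ tendsto_const]) (use \<theta> in auto)
    then show "((\<lambda>y. M * \<bar>y - x\<bar> powr \<theta>) \<longlongrightarrow> 0) (at x)" by (rule tendsto_mult_right_zero)
  qed
  then show "isCont (deriv f) x" by (simp add: isCont_def LIM_zero_iff)
qed

text \<open>Integration by parts moves the derivative of the flux w V onto the weight, which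
  produces the factor 1+\<alpha>. The boundary terms vanish: at 0 the flux is O(|z|^(2+\<theta>)),
  against a weight of order -1-\<alpha>, and at infinity it is bounded while the weight
  decays.\<close>

lemma integral_weight_of_flux:
  fixes w V q :: "real \<Rightarrow> real"
  assumes \<alpha>: "1 < \<alpha>" "\<alpha> < 2" and \<theta>: "\<alpha> - 1 < \<theta>" and w: "C1_holder_bound \<theta> M w"
    and nonneg: "\<And>z. 0 \<le> w z" and w0: "w 0 = 0" "deriv w 0 = 0"
    and V: "\<And>z. V z = - K * drift \<alpha> w z" and VL: "\<And>z. \<bar>V z\<bar> \<le> L * \<bar>z\<bar>" and VB: "\<And>z. \<bar>V z\<bar> \<le> B"
    and D: "\<And>z. ((\<lambda>z. w z * V z) has_real_derivative - q z) (at z)"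
    and qi: "integrable lborel (\<lambda>z. q z * \<bar>z\<bar> powr (-1-\<alpha>))"
  shows "(LINT z|lborel. q z * \<bar>z\<bar> powr (-1-\<alpha>))
    = (1 + \<alpha>) * K * (LINT z|lborel. signed_powr (-(2+\<alpha>)) z * w z * drift \<alpha> w z)"
proof -
  define H where "H = (\<lambda>z. (w z * V z) * \<bar>z\<bar> powr (-1-\<alpha>))"
  let ?d = "\<lambda>z. signed_powr (-(2+\<alpha>)) z * w z * drift \<alpha> w z"
  note wi = integrable_profile_drift[OF \<alpha> \<theta> w nonneg w0]
  have M0: "0 \<le> M" and L0: "0 \<le> L" using C1_holder_bound_nonneg[OF w] VL[of 1] by auto
  have dH: "(H has_real_derivative ((1 + \<alpha>) * K * ?d z - q z * \<bar>z\<bar> powr (-1-\<alpha>))) (at z)" if "z \<noteq> 0" for z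
  proof -
    have e: "-1-\<alpha>-1 = -(2+\<alpha>)" by simp
    have "((\<lambda>z. \<bar>z\<bar> powr (-1-\<alpha>)) has_real_derivative (-1-\<alpha>) * signed_powr (-(2+\<alpha>)) z) (at z)"
      using powr_deriv_off_zero[OF that, of "-1-\<alpha>"] unfolding e by simp
    from DERIV_mult[OF D this] show ?thesis
      unfolding H_def by (rule DERIV_cong) (simp add: V algebra_simps)
  qed
  have "((\<lambda>z. (1 + \<alpha>) * K * ?d z - q z * \<bar>z\<bar> powr (-1-\<alpha>)) has_integral 0) UNIV"
  proof (rule has_integral_derivative_vanishing_at_infinity[OF _ dH])
    have "isCont H z" if "z \<noteq> 0" for z using dH[OF that] DERIV_isCont by blast
    moreover have "isCont H 0"
      unfolding isCont_def
    proof (rule Lim_null_comparison[where g="\<lambda>z. M * L * \<bar>z\<bar> powr (1 + \<theta> - \<alpha>)", THEN tendsto_eq_rhs])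
      show "\<forall>\<^sub>F z in at 0. norm (H z) \<le> M * L * \<bar>z\<bar> powr (1 + \<theta> - \<alpha>)"
      proof (intro eventually_at_filter[THEN iffD2] always_eventually allI impI)
        fix z :: real assume "z \<noteq> 0"
        have "norm (H z) \<le> (M * \<bar>z\<bar> powr (1 + \<theta>)) * (L * \<bar>z\<bar>) * \<bar>z\<bar> powr (-1-\<alpha>)"
          unfolding H_def real_norm_def abs_mult
          using profile_le_powr[OF \<alpha> \<theta> w nonneg w0, of z] VL[of z] nonneg[of z] M0 L0
          by (intro mult_mono mult_nonneg_nonneg) auto
        also have "\<dots> = M * L * (\<bar>z\<bar> powr (1 + \<theta>) * \<bar>z\<bar> powr 1 * \<bar>z\<bar> powr (-1-\<alpha>))"
          by simp
        also have "\<dots> = M * L * \<bar>z\<bar> powr (1 + \<theta> - \<alpha>)"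
          by (simp only: powr_add[symmetric]) (simp add: add_diff_eq)
        finally show "norm (H z) \<le> M * L * \<bar>z\<bar> powr (1 + \<theta> - \<alpha>)" .
      qed
      have "((\<lambda>z::real. \<bar>z\<bar>) \<longlongrightarrow> 0) (at 0)" by (auto intro!: tendsto_eq_intros)
      then have "((\<lambda>z. \<bar>z\<bar> powr (1 + \<theta> - \<alpha>)) \<longlongrightarrow> 0) (at 0)"
        by (rule tendsto_zero_powrI[OF _ tendsto_const]) (use \<theta> in auto)
      then show "((\<lambda>z. M * L * \<bar>z\<bar> powr (1 + \<theta> - \<alpha>)) \<longlongrightarrow> 0) (at 0)"
        by (rule tendsto_mult_right_zero)
    qed (simp add: H_def)
    ultimately show "continuous_on UNIV H" by (metis continuous_at_imp_continuous_on)
    show "(H \<longlongrightarrow> 0) at_infinity"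
    proof (rule Lim_null_comparison)
      have "norm (H z) \<le> (M * B) * \<bar>z - 0\<bar> powr (-1-\<alpha>)" for z
      proof -
        have "\<bar>w z\<bar> * \<bar>V z\<bar> \<le> M * B"
          using C1_holder_boundD(2)[OF w, of z] VB[of z] M0 by (intro mult_mono) auto
        then show ?thesis unfolding H_def real_norm_def abs_mult by (simp add: mult_right_mono)
      qed
      then show "\<forall>\<^sub>F z in at_infinity. norm (H z) \<le> (M * B) * \<bar>z - 0\<bar> powr (-1-\<alpha>)" by simp
      show "((\<lambda>z. (M * B) * \<bar>z - 0\<bar> powr (-1-\<alpha>)) \<longlongrightarrow> 0) at_infinity"
        using \<alpha> by (intro tendsto_mult_right_zero powr_tendsto_0_at_infinity) simp
    qed
  qed
  moreover have "((\<lambda>z. (1 + \<alpha>) * K * ?d z - q z * \<bar>z\<bar> powr (-1-\<alpha>)) has_integral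
      (LINT z|lborel. (1 + \<alpha>) * K * ?d z - q z * \<bar>z\<bar> powr (-1-\<alpha>))) UNIV"
    using wi qi by (intro has_integral_integral_lborel Bochner_Integration.integrable_diff integrable_mult_right)
  ultimately have "(LINT z|lborel. (1 + \<alpha>) * K * ?d z - q z * \<bar>z\<bar> powr (-1-\<alpha>)) = 0"
    using has_integral_unique by blast
  then show ?thesis
    by (subst (asm) Bochner_Integration.integral_diff[OF integrable_mult_right[OF wi] qi]) simp
qed

section \<open>The solution on a closed time interval, seen along characteristics\<close>

context
  fixes \<alpha> \<theta> M S :: real and u u' :: "real \<Rightarrow> real \<Rightarrow> real"
  assumes \<alpha>: "1 < \<alpha>" "\<alpha> < 2" and \<theta>: "\<alpha> - 1 < \<theta>" and S: "0 \<le> S"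
    and bd: "\<And>t. t \<in> {0..S} \<Longrightarrow> C1_holder_bound \<theta> M (u t)"
    and ct: "\<And>t e. t \<in> {0..S} \<Longrightarrow> 0 < e \<Longrightarrow>
       eventually (\<lambda>\<tau>. C1_holder_bound \<theta> e (\<lambda>x. u \<tau> x - u t x)) (at t within {0..S})"
    and dt: "\<And>t e. t \<in> {0..S} \<Longrightarrow> 0 < e \<Longrightarrow>
       eventually (\<lambda>\<tau>. \<forall>x. \<bar>(u \<tau> x - u t x) / (\<tau> - t) - u' t x\<bar> \<le> e) (at t within {0..S})"
    and cu': "\<And>t. t \<in> {0..S} \<Longrightarrow> continuous_on UNIV (u' t)"
    and flux: "\<And>t x. t \<in> {0..S} \<Longrightarrow>
       ((\<lambda>y. u t y * LambdaH \<alpha> (u t) y) has_real_derivative - u' t x) (at x)"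
    and init: "\<And>x. 0 \<le> u 0 x" "u 0 0 = 0"
begin

lemma velocity_lipschitz:
  obtains L where "0 \<le> L" "\<And>t x y. t \<in> {0..S} \<Longrightarrow> \<bar>LambdaH \<alpha> (u t) x - LambdaH \<alpha> (u t) y\<bar> \<le> L * \<bar>x - y\<bar>"
proof (rule that)
  let ?L = "flow_const \<alpha> * (2 * (LINT s|lborel. two_powr (\<theta> - \<alpha>) (-\<alpha>) s)) * M"
  show "0 \<le> ?L"
    using flow_const_pos[OF \<alpha>] C1_holder_bound_nonneg[OF bd[of 0]] S
    by (intro mult_nonneg_nonneg integral_nonneg) auto
  show "\<bar>LambdaH \<alpha> (u t) x - LambdaH \<alpha> (u t) y\<bar> \<le> ?L * \<bar>x - y\<bar>" if "t \<in> {0..S}" for t x y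
    by (rule LambdaH_lipschitz[OF \<alpha> \<theta> bd[OF that]])
qed

lemma velocity_bounded:
  obtains B where "\<And>t x. t \<in> {0..S} \<Longrightarrow> \<bar>LambdaH \<alpha> (u t) x\<bar> \<le> B"
  using that abs_LambdaH_le[OF \<alpha> \<theta> bd] by blast

lemma velocity_continuous: "continuous_on {0..S} (\<lambda>t. LambdaH \<alpha> (u t) x)"
  unfolding continuous_on_def
proof
  fix t assume t: "t \<in> {0..S}"
  let ?C = "flow_const \<alpha> * (2 * (LINT s|lborel. two_powr (1 - \<alpha>) (-\<alpha>) s))"
  have C: "0 \<le> ?C"
    using flow_const_pos[OF \<alpha>] by (intro mult_nonneg_nonneg integral_nonneg) auto
  show "((\<lambda>t. LambdaH \<alpha> (u t) x) \<longlongrightarrow> LambdaH \<alpha> (u t) x) (at t within {0..S})"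
  proof (rule tendstoI)
    fix e :: real assume e: "0 < e"
    define e' where "e' = e / (?C + 1)"
    have e': "0 < e'" "?C * e' < e" using e C by (auto simp: e'_def field_simps)
    have "eventually (\<lambda>\<tau>. \<tau> \<in> {0..S}) (at t within {0..S})" by (auto simp: eventually_at_filter)
    then show "eventually (\<lambda>\<tau>. dist (LambdaH \<alpha> (u \<tau>) x) (LambdaH \<alpha> (u t) x) < e) (at t within {0..S})"
      using ct[OF t e'(1)]
    proof eventually_elim
      case (elim \<tau>)
      have "\<bar>LambdaH \<alpha> (\<lambda>x. u \<tau> x - u t x) x\<bar> \<le> ?C * e'" by (rule abs_LambdaH_le[OF \<alpha> \<theta> elim(2)])
      then show ?case using e'(2) LambdaH_diff[OF \<alpha> \<theta> bd[OF elim(1)] bd[OF t], of x]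
        by (simp add: dist_real_def)
    qed
  qed
qed

text \<open>The increment is split at u t (X \<tau> + z). The time part uses that \<open>dt\<close>
  is uniform in x, so the difference quotient may be taken at a moving point, and continuity of u'
  t; the space part is the chain rule at the fixed time t.\<close>

lemma has_derivative_along_curve:
  assumes t: "t \<in> A" and A: "A \<subseteq> {0..S}"
    and X: "(X has_real_derivative X') (at t within A)"
  shows "((\<lambda>\<tau>. u \<tau> (X \<tau> + z)) has_real_derivative u' t (X t + z) + deriv (u t) (X t + z) * X') (at t within A)"
proof -
  have tS: "t \<in> {0..S}" using t A by auto
  have dX: "((\<lambda>\<tau>. X \<tau> + z) has_real_derivative X') (at t within A)"
    using X by (auto intro!: derivative_eq_intros)
  have 2: "((\<lambda>\<tau>. u t (X \<tau> + z)) has_real_derivative deriv (u t) (X t + z) * X') (at t within A)"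
    by (rule DERIV_chain2[OF C1_holder_boundD(1)[OF bd[OF tS]] dX])
  have Xc: "((\<lambda>\<tau>. X \<tau> + z) \<longlongrightarrow> X t + z) (at t within A)"
    using DERIV_continuous[OF dX] by (simp add: continuous_within)
  have 1: "((\<lambda>\<tau>. u \<tau> (X \<tau> + z) - u t (X \<tau> + z)) has_real_derivative u' t (X t + z)) (at t within A)"
    unfolding has_field_derivative_iff
  proof -
    have "((\<lambda>\<tau>. (u \<tau> (X \<tau> + z) - u t (X \<tau> + z)) / (\<tau> - t) - u' t (X \<tau> + z)) \<longlongrightarrow> 0) (at t within A)"
    proof (rule tendstoI)
      fix e :: real assume e: "0 < e"
      have "eventually (\<lambda>\<tau>. \<forall>x. \<bar>(u \<tau> x - u t x) / (\<tau> - t) - u' t x\<bar> \<le> e / 2) (at t within A)"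
        using dt[OF tS, of "e / 2"] e filter_leD[OF at_le[OF A]] by auto
      then show "eventually (\<lambda>\<tau>. dist ((u \<tau> (X \<tau> + z) - u t (X \<tau> + z)) / (\<tau> - t) - u' t (X \<tau> + z)) 0 < e) (at t within A)"
      proof eventually_elim
        case (elim \<tau>)
        from elim[rule_format, of "X \<tau> + z"] show ?case using e by simp
      qed
    qed
    moreover have "((\<lambda>\<tau>. u' t (X \<tau> + z)) \<longlongrightarrow> u' t (X t + z)) (at t within A)"
    proof (rule isCont_tendsto_compose[OF _ Xc])
      show "isCont (u' t) (X t + z)" using cu'[OF tS] by (simp add: continuous_on_eq_continuous_at)
    qed
    ultimately have "((\<lambda>\<tau>. ((u \<tau> (X \<tau> + z) - u t (X \<tau> + z)) / (\<tau> - t) - u' t (X \<tau> + z)) + u' t (X \<tau> + z))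
        \<longlongrightarrow> 0 + u' t (X t + z)) (at t within A)" by (rule tendsto_add)
    then show "((\<lambda>\<tau>. (u \<tau> (X \<tau> + z) - u t (X \<tau> + z) - (u t (X t + z) - u t (X t + z))) / (\<tau> - t))
        \<longlongrightarrow> u' t (X t + z)) (at t within A)" by simp
  qed
  from DERIV_add[OF 1 2] show ?thesis by simp
qed

text \<open>Along the curve the derivative is v u_x minus the derivative of the flux, at most L |u|
  by \<open>deriv_of_product_lipschitz_bound\<close>. The zero is carried from t0 to t1 in either
  time order.\<close>

lemma zero_along_characteristic:
  assumes ab: "{a..b} \<subseteq> {0..S}"
    and X: "\<And>t. t \<in> {a..b} \<Longrightarrow> (X has_real_derivative LambdaH \<alpha> (u t) (X t)) (at t within {a..b})"
    and t0: "t0 \<in> {a..b}" "u t0 (X t0) = 0" and t1: "t1 \<in> {a..b}"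
  shows "u t1 (X t1) = 0"
proof -
  obtain L where L: "\<And>t x y. t \<in> {0..S} \<Longrightarrow> \<bar>LambdaH \<alpha> (u t) x - LambdaH \<alpha> (u t) y\<bar> \<le> L * \<bar>x - y\<bar>"
    by (rule velocity_lipschitz) blast
  show ?thesis
  proof (rule zero_of_deriv_le_abs[where g="\<lambda>t. u t (X t)" and L=L, OF _ _ t0 t1])
    fix t assume t: "t \<in> {a..b}"
    then have tS: "t \<in> {0..S}" using ab by auto
    show "((\<lambda>t. u t (X t)) has_real_derivative u' t (X t) + deriv (u t) (X t) * LambdaH \<alpha> (u t) (X t)) (at t within {a..b})"
      using has_derivative_along_curve[OF t ab X[OF t], of 0] by simp
    show "\<bar>u' t (X t) + deriv (u t) (X t) * LambdaH \<alpha> (u t) (X t)\<bar> \<le> L * \<bar>u t (X t)\<bar>"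
      using deriv_of_product_lipschitz_bound[OF C1_holder_boundD(1)[OF bd[OF tS]] L[OF tS] flux[OF tS], of "X t"]
      by (simp add: mult.commute)
  qed
qed

text \<open>Follow the characteristic through a negative value back to time 0, where u is
  nonnegative. By the intermediate value theorem u vanishes somewhere along it, hence also at its
  endpoint, a contradiction.\<close>

lemma solution_nonneg:
  assumes t: "t \<in> {0..S}"
  shows "0 \<le> u t x"
proof (rule ccontr)
  assume neg: "\<not> 0 \<le> u t x"
  have sub: "{0..t} \<subseteq> {0..S}" and t0: "0 \<le> t" using t by auto
  obtain L where L: "0 \<le> L" "\<And>t x y. t \<in> {0..S} \<Longrightarrow> \<bar>LambdaH \<alpha> (u t) x - LambdaH \<alpha> (u t) y\<bar> \<le> L * \<bar>x - y\<bar>"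
    by (rule velocity_lipschitz) blast
  obtain B where B: "\<And>t x. t \<in> {0..S} \<Longrightarrow> \<bar>LambdaH \<alpha> (u t) x\<bar> \<le> B"
    by (rule velocity_bounded) blast
  obtain X where X: "X t = x" "\<And>s. s \<in> {0..t} \<Longrightarrow> (X has_real_derivative LambdaH \<alpha> (u s) (X s)) (at s within {0..t})"
    by (rule picard_lindelof_backward[of 0 t L "\<lambda>t. LambdaH \<alpha> (u t)" B x])
       (use t0 L B sub in \<open>auto intro: continuous_on_subset[OF velocity_continuous]\<close>)
  have "continuous_on {0..t} (\<lambda>s. u s (X s + 0))"
    by (rule DERIV_continuous_on) (rule has_derivative_along_curve[OF _ sub X(2)])
  then have "\<exists>s\<ge>0. s \<le> t \<and> u s (X s) = 0"
    using IVT2'[of "\<lambda>s. u s (X s)" t 0 0] init neg X(1) t0 by auto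
  then obtain s where "s \<in> {0..t}" "u s (X s) = 0" by auto
  then have "u t (X t) = 0"
    using zero_along_characteristic[OF sub X(2), of s t] t0 by auto
  then show False using neg X(1) by simp
qed

text \<open>The Riccati inequality for \<open>J\<close> on [0,S]. The bound on S involves only
  \<alpha> and the initial mass, neither M nor the Lipschitz constant of the velocity.\<close>

lemma weighted_mass_blowup:
  assumes pos: "0 < (LINT z|lborel. u 0 z * \<bar>z\<bar> powr (-1-\<alpha>))"
  shows "(1 + \<alpha>) * flow_const \<alpha> / 2 * S * (LINT z|lborel. u 0 z * \<bar>z\<bar> powr (-1-\<alpha>)) \<le> 1"
proof -
  obtain L where L: "0 \<le> L" "\<And>t x y. t \<in> {0..S} \<Longrightarrow> \<bar>LambdaH \<alpha> (u t) x - LambdaH \<alpha> (u t) y\<bar> \<le> L * \<bar>x - y\<bar>"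
    by (rule velocity_lipschitz) blast
  obtain B where B: "\<And>t x. t \<in> {0..S} \<Longrightarrow> \<bar>LambdaH \<alpha> (u t) x\<bar> \<le> B"
    by (rule velocity_bounded) blast
  obtain X where X0: "X 0 = 0"
    and X: "\<And>t. t \<in> {0..S} \<Longrightarrow> (X has_real_derivative LambdaH \<alpha> (u t) (X t)) (at t within {0..S})"
    by (rule picard_lindelof[of 0 S L "\<lambda>t. LambdaH \<alpha> (u t)" B 0])
       (use S L B in \<open>auto intro: velocity_continuous\<close>)
  define w where "w = (\<lambda>t z. u t (X t + z))"
  \<comment> \<open>The time derivative of w in the moving frame; the second term comes from the
    motion of the origin.\<close>
  define q where "q = (\<lambda>t z. u' t (X t + z) + deriv (u t) (X t + z) * LambdaH \<alpha> (u t) (X t))"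
  define J where "J = (\<lambda>t. LINT z|lborel. w t z * \<bar>z\<bar> powr (-1-\<alpha>))"
  define Q where "Q = (\<lambda>t. LINT z|lborel. q t z * \<bar>z\<bar> powr (-1-\<alpha>))"
  \<comment> \<open>A time-independent majorant of the weighted q. It follows from |q| \<le> L w + L
    |z| |w'|: both terms are O(|z|^(1+\<theta>)) near 0 and O(|z|) far away.\<close>
  define b where "b = (\<lambda>z. 2 * L * M * two_powr (\<theta> - \<alpha>) (-\<alpha>) z)"
  have M: "0 \<le> M" using C1_holder_bound_nonneg[OF bd[of 0]] S by simp
  have wb: "C1_holder_bound \<theta> M (w t)" and dw: "deriv (w t) z = deriv (u t) (X t + z)" if "t \<in> {0..S}" for t z
    unfolding w_def using C1_holder_bound_shift[OF bd[OF that], of "X t"] by auto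
  have wn: "0 \<le> w t z" if "t \<in> {0..S}" for t z
    unfolding w_def by (rule solution_nonneg[OF that])
  have w0: "w t 0 = 0" if "t \<in> {0..S}" for t
    using zero_along_characteristic[OF order_refl X, of 0 t] that S init(2) X0 by (simp add: w_def)
  \<comment> \<open>The slope is not transported separately: a zero of a nonnegative function is a
    minimum.\<close>
  have dw0: "deriv (w t) 0 = 0" if "t \<in> {0..S}" for t
    by (rule DERIV_local_min[OF C1_holder_boundD(1)[OF wb[OF that]], of 1])
       (use wn[OF that] w0[OF that] in auto)
  note st = \<alpha> \<theta> wb wn w0 dw0
  have wt: "((\<lambda>\<tau>. w \<tau> z) has_real_derivative q t z) (at t within {0..S})" if "t \<in> {0..S}" for t z
    unfolding w_def q_def by (rule has_derivative_along_curve[OF that order_refl X[OF that]])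
  have qb: "\<bar>q t z\<bar> * \<bar>z\<bar> powr (-1-\<alpha>) \<le> b z" if t: "t \<in> {0..S}" for t z
  proof -
    let ?v = "LambdaH \<alpha> (u t)" and ?x = "X t + z"
    have "\<bar>- u' t ?x - ?v ?x * deriv (u t) ?x\<bar> \<le> L * \<bar>u t ?x\<bar>"
      by (rule deriv_of_product_lipschitz_bound[OF C1_holder_boundD(1)[OF bd[OF t]] L(2)[OF t] flux[OF t]])
    moreover have "\<bar>(?v ?x - ?v (X t)) * deriv (u t) ?x\<bar> \<le> (L * \<bar>z\<bar>) * \<bar>deriv (w t) z\<bar>"
      unfolding abs_mult dw[OF t] using L(2)[OF t, of ?x "X t"] by (intro mult_right_mono) auto
    \<comment> \<open>Adding and subtracting the velocity at the point itself leaves the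
      product-rule defect and the relative velocity, which is O(z).\<close>
    moreover have "q t z = - (- u' t ?x - ?v ?x * deriv (u t) ?x) - (?v ?x - ?v (X t)) * deriv (u t) ?x"
      by (simp add: q_def algebra_simps)
    ultimately have q: "\<bar>q t z\<bar> \<le> L * w t z + L * \<bar>z\<bar> * \<bar>deriv (w t) z\<bar>"
      using wn[OF t, of z] by (simp add: w_def)
    show ?thesis
    proof (cases "\<bar>z\<bar> \<le> 1")
      case True
      have "L * \<bar>z\<bar> * \<bar>deriv (w t) z\<bar> \<le> L * \<bar>z\<bar> * (M * \<bar>z\<bar> powr \<theta>)"
        using L by (intro mult_left_mono deriv_profile_le_powr[OF \<alpha> \<theta> wb wn w0 dw0] t) auto
      also have "\<dots> = L * (M * \<bar>z\<bar> powr (1 + \<theta>))"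
        by (cases "z = 0") (auto simp: powr_add)
      finally have "\<bar>q t z\<bar> \<le> 2 * L * M * \<bar>z\<bar> powr (1 + \<theta>)"
        using q mult_left_mono[OF profile_le_powr[OF \<alpha> \<theta> wb wn w0 dw0, OF t t t t, of z] L(1)] by simp
      then have "\<bar>q t z\<bar> * \<bar>z\<bar> powr (-1-\<alpha>) \<le> 2 * L * M * \<bar>z\<bar> powr (1 + \<theta>) * \<bar>z\<bar> powr (-1-\<alpha>)"
        by (rule mult_right_mono) simp
      also have "\<dots> = 2 * L * M * \<bar>z\<bar> powr (\<theta> - \<alpha>)" by (simp add: powr_add[symmetric])
      finally show ?thesis using True by (simp add: b_def two_powr_def)
    next
      case False
      have "L * w t z \<le> L * (M * \<bar>z\<bar>)"
        using C1_holder_boundD(2)[OF wb[OF t], of z] wn[OF t, of z] False M L mult_left_mono[of 1 "\<bar>z\<bar>" M]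
        by (intro mult_left_mono) auto
      moreover have "L * \<bar>z\<bar> * \<bar>deriv (w t) z\<bar> \<le> L * \<bar>z\<bar> * M"
        using L C1_holder_boundD(3)[OF wb[OF t], of z] by (intro mult_left_mono) auto
      ultimately have "\<bar>q t z\<bar> \<le> 2 * L * M * \<bar>z\<bar>" using q by (simp add: mult_ac)
      then have "\<bar>q t z\<bar> * \<bar>z\<bar> powr (-1-\<alpha>) \<le> 2 * L * M * \<bar>z\<bar> * \<bar>z\<bar> powr (-1-\<alpha>)"
        by (rule mult_right_mono) simp
      also have "\<dots> = 2 * L * M * (\<bar>z\<bar> powr 1 * \<bar>z\<bar> powr (-1-\<alpha>))" by simp
      also have "\<dots> = 2 * L * M * \<bar>z\<bar> powr (-\<alpha>)" by (simp only: powr_add[symmetric]) simp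
      finally show ?thesis using False by (simp add: b_def two_powr_def)
    qed
  qed
  have bi: "integrable lborel b"
    unfolding b_def using \<alpha> \<theta> by (intro integrable_mult_right integrable_two_powr) auto
  have qm: "q t \<in> borel_measurable borel" if t: "t \<in> {0..S}" for t
    unfolding q_def
    by (intro borel_measurable_continuous_onI continuous_intros
        continuous_on_compose2[OF cu'[OF t]] continuous_on_compose2[OF C1_holder_bound_deriv_continuous[OF bd[OF t]]])
       (use \<alpha> \<theta> in auto)
  have qi: "integrable lborel (\<lambda>z. q t z * \<bar>z\<bar> powr (-1-\<alpha>))" if t: "t \<in> {0..S}" for t
    by (rule Bochner_Integration.integrable_bound[OF bi])
       (use qb[OF t] qm[OF t] in \<open>auto simp: abs_mult intro!: order_trans[OF _ abs_ge_self]\<close>)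
  have wi: "integrable lborel (\<lambda>z. w t z * \<bar>z\<bar> powr (-1-\<alpha>))" if t: "t \<in> {0..S}" for t
    by (rule integrable_profile_weight[OF \<alpha> \<theta> wb wn w0 dw0, OF t t t t])
  have JQ: "(J has_real_derivative Q t) (at t within {0..S})" if t: "t \<in> {0..S}" for t
    unfolding has_field_derivative_iff tendsto_at_iff_sequentially
  proof (intro allI impI)
    fix \<tau> assume \<tau>: "\<forall>i. \<tau> i \<in> {0..S} - {t}" "\<tau> \<longlonglongrightarrow> t"
    then have \<tau>S: "\<tau> i \<in> {0..S}" "\<tau> i \<noteq> t" for i by auto
    let ?s = "\<lambda>i z. (w (\<tau> i) z * \<bar>z\<bar> powr (-1-\<alpha>) - w t z * \<bar>z\<bar> powr (-1-\<alpha>)) / (\<tau> i - t)"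
    have lim: "(\<lambda>i. LINT z|lborel. ?s i z) \<longlonglongrightarrow> Q t"
      unfolding Q_def
    proof (rule integral_dominated_convergence[where w=b, OF _ _ bi])
      show "(\<lambda>z. q t z * \<bar>z\<bar> powr (-1-\<alpha>)) \<in> borel_measurable lborel" using qi[OF t] by auto
      show "?s i \<in> borel_measurable lborel" for i
        using wi[OF \<tau>S(1), THEN borel_measurable_integrable] wi[OF t, THEN borel_measurable_integrable] by measurable
      show "AE z in lborel. (\<lambda>i. ?s i z) \<longlonglongrightarrow> q t z * \<bar>z\<bar> powr (-1-\<alpha>)"
      proof (intro AE_I2)
        fix z
        have "((\<lambda>\<tau>. w \<tau> z * \<bar>z\<bar> powr (-1-\<alpha>)) has_real_derivative q t z * \<bar>z\<bar> powr (-1-\<alpha>)) (at t within {0..S})"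
          by (rule DERIV_cmult_right[OF wt[OF t]])
        then show "(\<lambda>i. ?s i z) \<longlonglongrightarrow> q t z * \<bar>z\<bar> powr (-1-\<alpha>)"
          unfolding has_field_derivative_iff tendsto_at_iff_sequentially using \<tau> by (auto simp: o_def)
      qed
      show "AE z in lborel. norm (?s i z) \<le> b z" for i
      proof (intro AE_I2)
        fix z
        \<comment> \<open>The mean value inequality in time: \<open>b\<close> bounds the rate at all
          times, hence every difference quotient, as dominated convergence requires.\<close>
        have "norm (w (\<tau> i) z * \<bar>z\<bar> powr (-1-\<alpha>) - w t z * \<bar>z\<bar> powr (-1-\<alpha>)) \<le> b z * norm (\<tau> i - t)"
          by (rule field_differentiable_bound[of "{0..S}" _ "\<lambda>s. q s z * \<bar>z\<bar> powr (-1-\<alpha>)"])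
             (use DERIV_cmult_right[OF wt] qb \<tau>S t in \<open>auto simp: abs_mult\<close>)
        then show "norm (?s i z) \<le> b z"
          using \<tau>S(2)[of i] by (simp add: divide_le_eq)
      qed
    qed
    have eq: "(LINT z|lborel. ?s i z) = (J (\<tau> i) - J t) / (\<tau> i - t)" for i
      unfolding J_def using wi[OF \<tau>S(1)] wi[OF t] by simp
    show "((\<lambda>y. (J y - J t) / (y - t)) \<circ> \<tau>) \<longlonglongrightarrow> Q t"
      unfolding o_def eq[symmetric] by (rule lim)
  qed
  have QJ: "(1 + \<alpha>) * flow_const \<alpha> / 2 * (J t)\<^sup>2 \<le> Q t" if t: "t \<in> {0..S}" for t
  proof -
    \<comment> \<open>With the relative velocity V the transport term in q becomes part of a flux:
      -q is the derivative of w V.\<close>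
    define V where "V = (\<lambda>z. LambdaH \<alpha> (u t) (X t + z) - LambdaH \<alpha> (u t) (X t))"
    have "Q t = (1 + \<alpha>) * flow_const \<alpha> * (LINT z|lborel. signed_powr (-(2+\<alpha>)) z * w t z * drift \<alpha> (w t) z)"
      unfolding Q_def
    proof (rule integral_weight_of_flux[OF \<alpha> \<theta> wb wn w0 dw0, OF t t t t, where V=V and L=L and B="2 * B"])
      show "V z = - flow_const \<alpha> * drift \<alpha> (w t) z" for z
        unfolding V_def drift_def w_def LambdaH_diff_eq(2)[OF \<alpha> \<theta> bd[OF t]] by (simp add: add.assoc)
      show "\<bar>V z\<bar> \<le> L * \<bar>z\<bar>" for z
        unfolding V_def using L(2)[OF t, of "X t + z" "X t"] by simp
      show "\<bar>V z\<bar> \<le> 2 * B" for z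
        unfolding V_def using B[OF t, of "X t + z"] B[OF t, of "X t"] by simp
      show "((\<lambda>z. w t z * V z) has_real_derivative - q t z) (at z)" for z
      proof -
        have "((\<lambda>z. u t (z + X t) * LambdaH \<alpha> (u t) (z + X t)) has_real_derivative - u' t (z + X t)) (at z)"
          using flux[OF t, of "z + X t"] DERIV_shift[of "\<lambda>y. u t y * LambdaH \<alpha> (u t) y" "- u' t (z + X t)" z "X t"] by simp
        from DERIV_diff[OF this DERIV_cmult_right[OF C1_holder_boundD(1)[OF wb[OF t]], of "LambdaH \<alpha> (u t) (X t)"]]
        have "((\<lambda>z. u t (z + X t) * LambdaH \<alpha> (u t) (z + X t) - w t z * LambdaH \<alpha> (u t) (X t))
           has_real_derivative - u' t (z + X t) - deriv (w t) z * LambdaH \<alpha> (u t) (X t)) (at z)" .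
        then show ?thesis
          unfolding V_def q_def dw[OF t] by (simp add: w_def add.commute right_diff_distrib)
      qed
    qed (rule qi[OF t])
    moreover have "(J t)\<^sup>2 \<le> 2 * (LINT z|lborel. signed_powr (-(2+\<alpha>)) z * w t z * drift \<alpha> (w t) z)"
      unfolding J_def by (rule quadratic_lower_bound[OF \<alpha> \<theta> wb wn w0 dw0, OF t t t t])
    then have "(1 + \<alpha>) * flow_const \<alpha> / 2 * (J t)\<^sup>2
        \<le> (1 + \<alpha>) * flow_const \<alpha> / 2 * (2 * (LINT z|lborel. signed_powr (-(2+\<alpha>)) z * w t z * drift \<alpha> (w t) z))"
      using \<alpha> flow_const_pos[OF \<alpha>] by (intro mult_left_mono) auto
    ultimately show ?thesis by simp
  qed
  have J0: "J 0 = (LINT z|lborel. u 0 z * \<bar>z\<bar> powr (-1-\<alpha>))" by (simp add: J_def w_def X0)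
  show ?thesis
    unfolding J0[symmetric]
    by (rule riccati_blowup_time[OF S _ _ JQ QJ]) (use pos \<alpha> flow_const_pos[OF \<alpha>] J0 in auto)
qed

end

section \<open>Hoelder solutions\<close>

text \<open>Membership supplies the upper bounds without which a real supremum says nothing about
  its members. All summands of the norm are nonnegative, so each is at most the norm.\<close>

lemma holder_norm_bounds:
  assumes f: "f \<in> holder_space s"
  defines "n \<equiv> nat \<lfloor>s\<rfloor>"
  shows "j \<le> n \<Longrightarrow> \<bar>(deriv ^^ j) f x\<bar> \<le> holder_norm s f"
    and "\<bar>(deriv ^^ n) f x - (deriv ^^ n) f y\<bar> \<le> holder_norm s f * \<bar>x - y\<bar> powr frac s"
proof -
  let ?A = "\<lambda>j. SUP x. \<bar>(deriv ^^ j) f x\<bar>"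
  let ?P = "{(x, y). x \<noteq> (y::real)}"
  let ?r = "\<lambda>(x, y). \<bar>(deriv ^^ n) f x - (deriv ^^ n) f y\<bar> / \<bar>x - y\<bar> powr frac s"
  have N: "holder_norm s f = (\<Sum>j\<le>n. ?A j) + (SUP p\<in>?P. ?r p)"
    by (simp add: holder_norm_def n_def)
  have A: "\<bar>(deriv ^^ j) f x\<bar> \<le> ?A j" if "j \<le> n" for j x
  proof (rule cSUP_upper)
    have "bounded (range ((deriv ^^ j) f))" using f that by (simp add: holder_space_def n_def)
    then obtain B where "\<And>x. \<bar>(deriv ^^ j) f x\<bar> \<le> B" by (auto simp: bounded_iff)
    then show "bdd_above (range (\<lambda>x. \<bar>(deriv ^^ j) f x\<bar>))" by (auto intro!: bdd_aboveI)
  qed simp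
  obtain C where C: "\<And>x y. \<bar>(deriv ^^ n) f x - (deriv ^^ n) f y\<bar> \<le> C * \<bar>x - y\<bar> powr frac s"
    using f by (auto simp: holder_space_def n_def)
  have "?r p \<le> C" if "p \<in> ?P" for p
    using that C by (auto simp: divide_le_eq)
  then have bdd: "bdd_above (?r ` ?P)" by (auto intro!: bdd_aboveI)
  have R: "?r (x, y) \<le> (SUP p\<in>?P. ?r p)" if "x \<noteq> y" for x y
    by (rule cSUP_upper[OF _ bdd]) (use that in auto)
  have R0: "0 \<le> (SUP p\<in>?P. ?r p)"
    by (rule order_trans[OF _ R[of 0 1]]) auto
  have A0: "0 \<le> ?A j" if "j \<le> n" for j
    using A[OF that, of 0] by linarith
  show "\<bar>(deriv ^^ j) f x\<bar> \<le> holder_norm s f" if "j \<le> n"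
  proof -
    have "?A j \<le> (\<Sum>j\<le>n. ?A j)"
      by (rule member_le_sum) (use that A0 in auto)
    then show ?thesis using A[OF that, of x] R0 N by linarith
  qed
  show "\<bar>(deriv ^^ n) f x - (deriv ^^ n) f y\<bar> \<le> holder_norm s f * \<bar>x - y\<bar> powr frac s"
  proof (cases "x = y")
    case False
    have "0 \<le> (\<Sum>j\<le>n. ?A j)" by (rule sum_nonneg) (use A0 in auto)
    then have "\<bar>(deriv ^^ n) f x - (deriv ^^ n) f y\<bar> / \<bar>x - y\<bar> powr frac s \<le> holder_norm s f"
      using R[OF False] N by simp
    then show ?thesis using False by (simp add: divide_le_eq)
  qed simp
qed

lemma floor_frac_1_2:
  assumes "1 < s" "s < (2::real)"
  shows "nat \<lfloor>s\<rfloor> = 1" "frac s = s - 1"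
proof -
  have "\<lfloor>s\<rfloor> = 1" using assms by linarith
  then show "nat \<lfloor>s\<rfloor> = 1" "frac s = s - 1" by (auto simp: frac_def)
qed

lemma floor_frac_0_1:
  assumes "0 < s" "s < (1::real)"
  shows "nat \<lfloor>s\<rfloor> = 0" "frac s = s"
proof -
  have "\<lfloor>s\<rfloor> = 0" using assms by linarith
  then show "nat \<lfloor>s\<rfloor> = 0" "frac s = s" by (auto simp: frac_def)
qed

lemma C1_holder_bound_holder_norm:
  assumes s: "1 < s" "s < 2" and f: "f \<in> holder_space s"
  shows "C1_holder_bound (s - 1) (holder_norm s f) f"
  using f holder_norm_bounds(1)[OF f, of 0] holder_norm_bounds(1)[OF f, of 1] holder_norm_bounds(2)[OF f]
  unfolding C1_holder_bound_def floor_frac_1_2[OF s] by (auto simp: holder_space_def floor_frac_1_2[OF s])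

lemma C1_holder_bound_holder_space:
  assumes s: "1 < s" "s < 2" and f: "C1_holder_bound (s - 1) M f"
  shows "f \<in> holder_space s"
proof -
  have "bounded (range ((deriv ^^ j) f))" if "j \<le> 1" for j
  proof -
    have "j = 0 \<or> j = 1" using that by auto
    then show ?thesis using C1_holder_boundD(2,3)[OF f] by (auto intro!: boundedI)
  qed
  then show ?thesis
    using f unfolding holder_space_def floor_frac_1_2[OF s] C1_holder_bound_def by auto
qed

lemma holder_norm_bounds_less_1:
  assumes d: "0 < \<delta>" "\<delta> < 1" and f: "f \<in> holder_space \<delta>"
  shows "\<bar>f x\<bar> \<le> holder_norm \<delta> f" "\<bar>f x - f y\<bar> \<le> holder_norm \<delta> f * \<bar>x - y\<bar> powr \<delta>"
  using holder_norm_bounds(1)[OF f, of 0 x] holder_norm_bounds(2)[OF f, of x y] floor_frac_0_1[OF d] by auto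

text \<open>\<open>holder_norm\<close> controls a function only on the space itself, so the
  remainder of the difference quotient must be shown to lie there before its small norm gives a
  uniform bound.\<close>

lemma holder_space_combination:
  assumes d: "0 < \<delta>" "\<delta> < 1" and f: "f \<in> holder_space \<delta>" and g: "g \<in> holder_space \<delta>" and h: "h \<in> holder_space \<delta>"
  shows "(\<lambda>x. (f x - g x) / c - h x) \<in> holder_space \<delta>"
proof -
  note n = holder_norm_bounds_less_1[OF d]
  let ?N = "holder_norm \<delta>" and ?F = "\<lambda>x. (f x - g x) / c - h x"
  have N: "0 \<le> ?N f" "0 \<le> ?N g" "0 \<le> ?N h" using n(1)[OF f, of 0] n(1)[OF g, of 0] n(1)[OF h, of 0] by linarith+
  have "\<bar>?F x\<bar> \<le> (?N f + ?N g) / \<bar>c\<bar> + ?N h" for x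
  proof -
    have "\<bar>(f x - g x) / c\<bar> \<le> (?N f + ?N g) / \<bar>c\<bar>"
      unfolding abs_divide using n(1)[OF f, of x] n(1)[OF g, of x] by (intro divide_right_mono) auto
    then show ?thesis using n(1)[OF h, of x] by linarith
  qed
  moreover have "\<bar>?F x - ?F y\<bar> \<le> ((?N f + ?N g) / \<bar>c\<bar> + ?N h) * \<bar>x - y\<bar> powr \<delta>" for x y
  proof -
    have "?F x - ?F y = ((f x - f y) - (g x - g y)) / c - (h x - h y)"
      by (simp add: diff_divide_distrib)
    moreover have "\<bar>((f x - f y) - (g x - g y)) / c\<bar> \<le> (?N f * \<bar>x - y\<bar> powr \<delta> + ?N g * \<bar>x - y\<bar> powr \<delta>) / \<bar>c\<bar>"
      unfolding abs_divide using n(2)[OF f, of x y] n(2)[OF g, of x y] by (intro divide_right_mono) auto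
    ultimately have "\<bar>?F x - ?F y\<bar> \<le> (?N f * \<bar>x - y\<bar> powr \<delta> + ?N g * \<bar>x - y\<bar> powr \<delta>) / \<bar>c\<bar> + ?N h * \<bar>x - y\<bar> powr \<delta>"
      using n(2)[OF h, of x y] by linarith
    then show ?thesis by (simp add: algebra_simps add_divide_distrib)
  qed
  ultimately show ?thesis
    unfolding holder_space_def floor_frac_0_1[OF d] by (auto intro!: boundedI)
qed

lemma holder_space_continuous:
  assumes d: "0 < \<delta>" "\<delta> < 1" and f: "f \<in> holder_space \<delta>"
  shows "continuous_on UNIV f"
proof (intro continuous_at_imp_continuous_on ballI)
  note n = holder_norm_bounds_less_1(2)[OF d f]
  fix x
  have "((\<lambda>y. f y - f x) \<longlongrightarrow> 0) (at x)"
  proof (rule Lim_null_comparison)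
    show "\<forall>\<^sub>F y in at x. norm (f y - f x) \<le> holder_norm \<delta> f * \<bar>y - x\<bar> powr \<delta>" using n by simp
    have "((\<lambda>y. \<bar>y - x\<bar>) \<longlongrightarrow> 0) (at x)" by (auto intro!: tendsto_eq_intros)
    then have "((\<lambda>y. \<bar>y - x\<bar> powr \<delta>) \<longlongrightarrow> 0) (at x)"
      by (rule tendsto_zero_powrI[OF _ tendsto_const]) (use d in auto)
    then show "((\<lambda>y. holder_norm \<delta> f * \<bar>y - x\<bar> powr \<delta>) \<longlongrightarrow> 0) (at x)" by (rule tendsto_mult_right_zero)
  qed
  then show "isCont f x" by (simp add: isCont_def LIM_zero_iff)
qed

text \<open>Continuity in the norm gives a common bound near each time; compactness of [0,S] makes
  it global. This is why the estimates run on closed intervals strictly inside the existence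
  interval.\<close>

lemma C0_holder_uniform_bound:
  assumes s: "1 < s" "s < 2" and u: "C0_holder T s u" and S: "S < T"
  obtains M where "\<And>t. t \<in> {0..S} \<Longrightarrow> C1_holder_bound (s - 1) M (u t)"
proof -
  have "\<exists>d>0. \<exists>M. \<forall>\<tau>\<in>{0..S}. dist \<tau> t < d \<longrightarrow> C1_holder_bound (s - 1) M (u \<tau>)" if t: "t \<in> {0..S}" for t
  proof -
    have tT: "t \<in> {0..<T}" using t S by auto
    have ut: "u t \<in> holder_space s" using u tT by (auto simp: C0_holder_def)
    have "((\<lambda>\<tau>. holder_norm s (\<lambda>x. u \<tau> x - u t x)) \<longlongrightarrow> 0) (at t within {0..<T})"
      using u tT by (auto simp: C0_holder_def)
    then have "eventually (\<lambda>\<tau>. holder_norm s (\<lambda>x. u \<tau> x - u t x) < 1) (at t within {0..<T})"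
      by (rule order_tendstoD) simp
    then obtain d where d: "d > 0" "\<And>\<tau>. \<tau> \<in> {0..<T} \<Longrightarrow> \<tau> \<noteq> t \<Longrightarrow> dist \<tau> t < d \<Longrightarrow> holder_norm s (\<lambda>x. u \<tau> x - u t x) < 1"
      unfolding eventually_at by auto
    have "C1_holder_bound (s - 1) (holder_norm s (u t) + 1) (u \<tau>)" if \<tau>: "\<tau> \<in> {0..S}" "dist \<tau> t < d" for \<tau>
    proof (cases "\<tau> = t")
      case True
      then show ?thesis using C1_holder_bound_mono[OF C1_holder_bound_holder_norm[OF s ut]] by simp
    next
      case False
      have \<tau>T: "\<tau> \<in> {0..<T}" using \<tau> S by auto
      have u\<tau>: "u \<tau> \<in> holder_space s" using u \<tau>T by (auto simp: C0_holder_def)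
      have "(\<lambda>x. u \<tau> x - u t x) \<in> holder_space s"
        by (rule C1_holder_bound_holder_space[OF s C1_holder_bound_diff[OF C1_holder_bound_holder_norm[OF s u\<tau>] C1_holder_bound_holder_norm[OF s ut]]])
      then have "C1_holder_bound (s - 1) 1 (\<lambda>x. u \<tau> x - u t x)"
        using C1_holder_bound_mono[OF C1_holder_bound_holder_norm[OF s]] d(2)[OF \<tau>T False \<tau>(2)] by simp
      from C1_holder_bound_add[OF C1_holder_bound_holder_norm[OF s ut] this] show ?thesis by simp
    qed
    then show ?thesis using d(1) by blast
  qed
  then obtain d M where dM: "\<And>t. t \<in> {0..S} \<Longrightarrow> d t > 0"
    "\<And>t \<tau>. t \<in> {0..S} \<Longrightarrow> \<tau> \<in> {0..S} \<Longrightarrow> dist \<tau> t < d t \<Longrightarrow> C1_holder_bound (s - 1) (M t) (u \<tau>)"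
    by metis
  obtain F where F: "F \<subseteq> {0..S}" "finite F" "{0..S} \<subseteq> (\<Union>t\<in>F. ball t (d t))"
    by (rule compactE_image[OF compact_Icc, of "{0..S}" "\<lambda>t. ball t (d t)" 0 S]) (use dM(1) in auto)
  \<comment> \<open>The sum of absolute values stands in for the maximum over the finite
    cover.\<close>
  have "C1_holder_bound (s - 1) (\<Sum>t\<in>F. \<bar>M t\<bar>) (u \<tau>)" if \<tau>: "\<tau> \<in> {0..S}" for \<tau>
  proof -
    obtain t where t: "t \<in> F" "dist \<tau> t < d t" using F(3) \<tau> by (auto simp: dist_commute)
    have "M t \<le> \<bar>M t\<bar>" by simp
    also have "\<dots> \<le> (\<Sum>t\<in>F. \<bar>M t\<bar>)" by (rule member_le_sum) (use t F in auto)
    finally show ?thesis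
      using C1_holder_bound_mono dM(2)[of t \<tau>] t F \<tau> by blast
  qed
  then show ?thesis by (rule that)
qed

lemma C1_holder_uniform_derivative:
  assumes d: "0 < \<delta>" "\<delta> < 1" and u: "C0_holder T \<delta> u" and u': "C0_holder T \<delta> u'"
    and lim: "((\<lambda>\<tau>. holder_norm \<delta> (\<lambda>x. (u \<tau> x - u t x) / (\<tau> - t) - u' t x)) \<longlongrightarrow> 0) (at t within {0..<T})"
    and t: "t \<in> {0..<T}"
  shows "0 < e \<Longrightarrow> eventually (\<lambda>\<tau>. \<forall>x. \<bar>(u \<tau> x - u t x) / (\<tau> - t) - u' t x\<bar> \<le> e) (at t within {0..<T})"
    and "((\<lambda>\<tau>. u \<tau> x) has_real_derivative u' t x) (at t within {0..<T})"
proof -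
  show 1: "eventually (\<lambda>\<tau>. \<forall>x. \<bar>(u \<tau> x - u t x) / (\<tau> - t) - u' t x\<bar> \<le> e) (at t within {0..<T})" if "0 < e" for e
  proof -
    have "eventually (\<lambda>\<tau>. \<tau> \<in> {0..<T}) (at t within {0..<T})" by (simp add: eventually_at_filter)
    moreover have "eventually (\<lambda>\<tau>. holder_norm \<delta> (\<lambda>x. (u \<tau> x - u t x) / (\<tau> - t) - u' t x) < e) (at t within {0..<T})"
      using lim that by (rule order_tendstoD)
    ultimately show ?thesis
    proof eventually_elim
      case (elim \<tau>)
      have "(\<lambda>x. (u \<tau> x - u t x) / (\<tau> - t) - u' t x) \<in> holder_space \<delta>"
        by (rule holder_space_combination[OF d]) (use u u' t elim in \<open>auto simp: C0_holder_def\<close>)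
      then have "\<bar>(u \<tau> x - u t x) / (\<tau> - t) - u' t x\<bar> \<le> e" for x
        using holder_norm_bounds_less_1(1)[OF d, of "\<lambda>x. (u \<tau> x - u t x) / (\<tau> - t) - u' t x" x] elim(2)
        by linarith
      then show ?case by blast
    qed
  qed
  show "((\<lambda>\<tau>. u \<tau> x) has_real_derivative u' t x) (at t within {0..<T})"
    unfolding has_field_derivative_iff
  proof (rule tendstoI)
    fix e :: real assume "0 < e"
    then have "0 < e / 2" "e / 2 < e" by auto
    from 1[OF this(1)] show "eventually (\<lambda>\<tau>. dist ((u \<tau> x - u t x) / (\<tau> - t)) (u' t x) < e) (at t within {0..<T})"
    proof eventually_elim
      case (elim \<tau>)
      from elim[rule_format, of x] show ?case using \<open>e / 2 < e\<close> unfolding dist_real_def by linarith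
    qed
  qed
qed

lemma has_real_derivative_unique_Ico:
  assumes "t \<in> {0..<T::real}" "(f has_real_derivative D) (at t within {0..<T})" "(f has_real_derivative E) (at t within {0..<T})"
  shows "D = E"
proof -
  have "at t within {0..<T} \<noteq> bot"
    using assms(1) by (simp add: trivial_limit_within)
  then show ?thesis
    using assms(2,3) has_field_derivative_unique by blast
qed

text \<open>The bound is 1/(c J) + 1, where c depends only on \<alpha> and J is the weighted mass of
  the datum, positive since the datum is continuous, nonnegative and not identically zero.\<close>

lemma existence_time_bounded:
  assumes \<alpha>: "1 < \<alpha>" "\<alpha> < 2" and s: "\<alpha> < s" "s < 2" and d: "0 < \<delta>" "\<delta> < 1"
    and nn: "\<And>x. 0 \<le> u\<^sub>0 x" and nz: "u\<^sub>0 x0 \<noteq> 0" and z: "u\<^sub>0 0 = 0"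
  obtains T where "\<And>S. 0 < S \<Longrightarrow> holder_solution \<alpha> s \<delta> S u\<^sub>0 u \<Longrightarrow> S \<le> T"
proof -
  define J where "J = (LINT z|lborel. u\<^sub>0 z * \<bar>z\<bar> powr (-1-\<alpha>))"
  define c where "c = (1 + \<alpha>) * flow_const \<alpha> / 2"
  have c: "0 < c" using flow_const_pos[OF \<alpha>] \<alpha> by (simp add: c_def)
  have s1: "1 < s" using \<alpha> s by simp
  have "S \<le> 1 / (c * J) + 1" if S: "0 < S" and sol: "holder_solution \<alpha> s \<delta> S u\<^sub>0 u" for S
  proof (rule ccontr)
    assume "\<not> S \<le> 1 / (c * J) + 1"
    then have less: "1 / (c * J) + 1 < S" by simp
    have C0: "C0_holder S s u" and C1: "C1_holder S \<delta> u" and slv: "solves \<alpha> S u\<^sub>0 u"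
      using sol by (auto simp: holder_solution_def)
    have u0: "u 0 = u\<^sub>0" using slv by (simp add: solves_def)
    obtain u' where u': "C0_holder S \<delta> u'"
      and lim: "\<And>t. t \<in> {0..<S} \<Longrightarrow> ((\<lambda>\<tau>. holder_norm \<delta> (\<lambda>x. (u \<tau> x - u t x) / (\<tau> - t) - u' t x)) \<longlongrightarrow> 0) (at t within {0..<S})"
      and C0d: "C0_holder S \<delta> u"
      using C1 by (auto simp: C1_holder_def)
    have us: "u t \<in> holder_space s" if "t \<in> {0..<S}" for t using C0 that by (auto simp: C0_holder_def)
    have dx: "C1_holder_bound (s - 1) (holder_norm s (u 0)) (u 0)"
      by (rule C1_holder_bound_holder_norm[OF s1 s(2) us]) (use S in auto)
    have d0: "deriv u\<^sub>0 0 = 0"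
      by (rule DERIV_local_min[OF C1_holder_boundD(1)[OF dx, unfolded u0], of 1]) (use nn z in auto)
    have \<theta>: "\<alpha> - 1 < s - 1" using s by simp
    have Ji: "integrable lborel (\<lambda>z. u\<^sub>0 z * \<bar>z\<bar> powr (-1-\<alpha>))"
      by (rule integrable_profile_weight[OF \<alpha> \<theta> dx[unfolded u0] nn z d0])
    have J: "0 < J"
    proof -
      let ?f = "\<lambda>z. u\<^sub>0 z * \<bar>z\<bar> powr (-1-\<alpha>)"
      have x0: "x0 \<noteq> 0" using nz z by auto
      have f0: "0 < ?f x0" using nn[of x0] nz x0 by auto
      have "isCont u\<^sub>0 x0" using C1_holder_boundD(1)[OF dx, unfolded u0] DERIV_isCont by blast
      then have "isCont ?f x0" using x0 by (auto intro!: continuous_intros)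
      then have "eventually (\<lambda>x. ?f x0 / 2 < ?f x) (at x0)"
        using f0 by (intro order_tendstoD) (auto simp: isCont_def)
      then obtain r where r: "0 < r" "\<And>x. x \<noteq> x0 \<Longrightarrow> dist x x0 < r \<Longrightarrow> ?f x0 / 2 < ?f x"
        by (auto simp: eventually_at)
      have lb: "indicator {x0..x0 + r / 2} x * (?f x0 / 2) \<le> ?f x" for x
        using r(2)[of x] f0 r(1) nn[of x] by (cases "x = x0") (auto simp: indicator_def dist_real_def)
      have "0 < (LINT x|lborel. indicator {x0..x0 + r / 2} x * (?f x0 / 2))"
        using r(1) f0 by simp
      also have "\<dots> \<le> J"
        unfolding J_def
        by (intro integral_mono Ji lb integrable_mult_left integrable_real_indicator emeasure_bounded_finite) auto
      finally show ?thesis .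
    qed
    \<comment> \<open>The added 1 leaves a strict contradiction: c S' J = 1 + c J, which exceeds
      1.\<close>
    define S' where "S' = 1 / (c * J) + 1"
    have S': "0 \<le> S'" "S' < S" using less c J by (auto simp: S'_def)
    have sub: "{0..S'} \<subseteq> {0..<S}" using S' by auto
    obtain M where M: "\<And>t. t \<in> {0..S'} \<Longrightarrow> C1_holder_bound (s - 1) M (u t)"
      by (rule C0_holder_uniform_bound[OF s1 s(2) C0 S'(2)]) blast
    have le: "eventually P (at t within {0..S'})" if "eventually P (at t within {0..<S})" for P t
      using filter_leD[OF at_le[OF sub] that] .
    have "(1 + \<alpha>) * flow_const \<alpha> / 2 * S' * (LINT z|lborel. u 0 z * \<bar>z\<bar> powr (-1-\<alpha>)) \<le> 1"
    proof (rule weighted_mass_blowup[OF \<alpha> \<theta> S'(1) M])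
      fix t assume t': "t \<in> {0..S'}"
      then have t: "t \<in> {0..<S}" using sub by auto
      note dd = C1_holder_uniform_derivative[OF d C0d u' lim[OF t] t]
      show "eventually (\<lambda>\<tau>. C1_holder_bound (s - 1) e (\<lambda>x. u \<tau> x - u t x)) (at t within {0..S'})" if "0 < e" for e
      proof -
        have "eventually (\<lambda>\<tau>. \<tau> \<in> {0..<S}) (at t within {0..<S})" by (simp add: eventually_at_filter)
        moreover have "eventually (\<lambda>\<tau>. holder_norm s (\<lambda>x. u \<tau> x - u t x) < e) (at t within {0..<S})"
          using C0 t that by (intro order_tendstoD) (auto simp: C0_holder_def)
        ultimately have "eventually (\<lambda>\<tau>. C1_holder_bound (s - 1) e (\<lambda>x. u \<tau> x - u t x)) (at t within {0..<S})"
        proof eventually_elim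
          case (elim \<tau>)
          have "(\<lambda>x. u \<tau> x - u t x) \<in> holder_space s"
            by (rule C1_holder_bound_holder_space[OF s1 s(2) C1_holder_bound_diff[OF
               C1_holder_bound_holder_norm[OF s1 s(2) us[OF elim(1)]] C1_holder_bound_holder_norm[OF s1 s(2) us[OF t]]]])
          from C1_holder_bound_mono[OF C1_holder_bound_holder_norm[OF s1 s(2) this]] elim(2) show ?case by simp
        qed
        then show ?thesis by (rule le)
      qed
      show "eventually (\<lambda>\<tau>. \<forall>x. \<bar>(u \<tau> x - u t x) / (\<tau> - t) - u' t x\<bar> \<le> e) (at t within {0..S'})" if "0 < e" for e
        by (rule le[OF dd(1)[OF that]])
      show "continuous_on UNIV (u' t)"
        by (rule holder_space_continuous[OF d]) (use u' t in \<open>auto simp: C0_holder_def\<close>)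
      show "((\<lambda>y. u t y * LambdaH \<alpha> (u t) y) has_real_derivative - u' t x) (at x)" for x
      proof -
        obtain u_t flux_x where *: "((\<lambda>\<tau>. u \<tau> x) has_real_derivative u_t) (at t within {0..<S})"
            "((\<lambda>y. u t y * LambdaH \<alpha> (u t) y) has_real_derivative flux_x) (at x)" "u_t + flux_x = 0"
          using slv t unfolding solves_def by blast
        \<comment> \<open>Identifies the pointwise time derivative in \<open>solves\<close> with the
          one converging in the Hoelder norm, so that the flux derivative is -u' t.\<close>
        have "u_t = u' t x" by (rule has_real_derivative_unique_Ico[OF t *(1) dd(2)])
        then have "flux_x = - u' t x" using *(3) by simp
        then show ?thesis using *(2) by simp
      qed
    qed (use nn z u0 J in \<open>auto simp: J_def\<close>)
    then have "c * S' * J \<le> 1" by (simp add: c_def J_def u0)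
    moreover have "c * S' * J = 1 + c * J" using c J by (simp add: S'_def field_simps)
    moreover have "0 < c * J" using c J by simp
    ultimately show False by simp
  qed
  then show ?thesis by (rule that)
qed

text \<open>Every condition is local in time on a half-open interval: a time t below the supremum
  lies below some S in A, and near t the filters within [0,S) and [0,Sup A) agree.\<close>

lemma holder_solution_Sup:
  assumes ne: "A \<noteq> {}" and bdd: "bdd_above A" and d: "0 < \<delta>" "\<delta> < 1"
    and sol: "\<And>S. S \<in> A \<Longrightarrow> 0 < S \<and> holder_solution \<alpha> s \<delta> S u\<^sub>0 u"
  shows "holder_solution \<alpha> s \<delta> (Sup A) u\<^sub>0 u"
proof -
  let ?T = "Sup A"
  have ex: "\<exists>S\<in>A. t \<in> {0..<S} \<and> at t within {0..<?T} = at t within {0..<S}" if t: "t \<in> {0..<?T}" for t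
  proof -
    obtain S where S: "S \<in> A" "t < S" using t less_cSup_iff[OF ne bdd] by auto
    have "S \<le> ?T" by (rule cSup_upper[OF S(1) bdd])
    then have "{0..<?T} \<inter> {..<S} - {t} = {0..<S} \<inter> {..<S} - {t}" by auto
    then have "at t within {0..<?T} = at t within {0..<S}"
      by (intro at_within_nhd[of t "{..<S}"]) (use S in auto)
    then show ?thesis using S t by auto
  qed
  have C0T: "C0_holder ?T r g" if "\<And>S. S \<in> A \<Longrightarrow> C0_holder S r g" for r g
    unfolding C0_holder_def
  proof
    fix t assume "t \<in> {0..<?T}"
    from ex[OF this] obtain S where S: "S \<in> A" "t \<in> {0..<S}" "at t within {0..<?T} = at t within {0..<S}" by auto
    show "g t \<in> holder_space r \<and> ((\<lambda>\<tau>. holder_norm r (\<lambda>x. g \<tau> x - g t x)) \<longlongrightarrow> 0) (at t within {0..<?T})"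
      using that[OF S(1)] S(2) unfolding S(3) C0_holder_def by blast
  qed
  \<comment> \<open>Each S brings its own witness for the time derivative. The unique pointwise
    derivative is one function that agrees with all of them.\<close>
  define u' where "u' = (\<lambda>t x. THE D. ((\<lambda>\<tau>. u \<tau> x) has_real_derivative D) (at t within {0..<?T}))"
  have u': "C0_holder S \<delta> u' \<and> (\<forall>t\<in>{0..<S}. ((\<lambda>\<tau>. holder_norm \<delta> (\<lambda>x. (u \<tau> x - u t x) / (\<tau> - t) - u' t x)) \<longlongrightarrow> 0)
             (at t within {0..<S}))" if S: "S \<in> A" for S
  proof -
    have "C1_holder S \<delta> u" using sol[OF S] by (simp add: holder_solution_def)
    then obtain v where v: "C0_holder S \<delta> v" and C0d: "C0_holder S \<delta> u"
      and lim: "\<And>t. t \<in> {0..<S} \<Longrightarrow> ((\<lambda>\<tau>. holder_norm \<delta> (\<lambda>x. (u \<tau> x - u t x) / (\<tau> - t) - v t x)) \<longlongrightarrow> 0) (at t within {0..<S})"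
      by (auto simp: C1_holder_def)
    have eq: "u' t = v t" if t: "t \<in> {0..<S}" for t
    proof
      fix x
      have "S \<le> ?T" by (rule cSup_upper[OF S bdd])
      then have tT: "t \<in> {0..<?T}" using t by auto
      have "{0..<?T} \<inter> {..<S} - {t} = {0..<S} \<inter> {..<S} - {t}" using \<open>S \<le> ?T\<close> by auto
      then have "at t within {0..<?T} = at t within {0..<S}"
        by (intro at_within_nhd[of t "{..<S}"]) (use t in auto)
      then have D: "((\<lambda>\<tau>. u \<tau> x) has_real_derivative v t x) (at t within {0..<?T})"
        using C1_holder_uniform_derivative(2)[OF d C0d v lim[OF t] t] by simp
      then show "u' t x = v t x"
        unfolding u'_def by (rule the_equality) (rule has_real_derivative_unique_Ico[OF tT _ D])
    qed
    have "C0_holder S \<delta> u'"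
      unfolding C0_holder_def
    proof
      fix t assume t: "t \<in> {0..<S}"
      have ev: "eventually (\<lambda>\<tau>. holder_norm \<delta> (\<lambda>x. v \<tau> x - v t x) = holder_norm \<delta> (\<lambda>x. u' \<tau> x - u' t x)) (at t within {0..<S})"
        using eq t by (simp add: eventually_at_filter)
      have "((\<lambda>\<tau>. holder_norm \<delta> (\<lambda>x. v \<tau> x - v t x)) \<longlongrightarrow> 0) (at t within {0..<S})"
        using v t by (simp add: C0_holder_def)
      then have "((\<lambda>\<tau>. holder_norm \<delta> (\<lambda>x. u' \<tau> x - u' t x)) \<longlongrightarrow> 0) (at t within {0..<S})"
        using ev by (rule Lim_transform_eventually)
      moreover have "u' t \<in> holder_space \<delta>" unfolding eq[OF t] using v t by (simp add: C0_holder_def)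
      ultimately show "u' t \<in> holder_space \<delta> \<and> ((\<lambda>\<tau>. holder_norm \<delta> (\<lambda>x. u' \<tau> x - u' t x)) \<longlongrightarrow> 0) (at t within {0..<S})"
        by blast
    qed
    moreover have "((\<lambda>\<tau>. holder_norm \<delta> (\<lambda>x. (u \<tau> x - u t x) / (\<tau> - t) - u' t x)) \<longlongrightarrow> 0) (at t within {0..<S})"
      if "t \<in> {0..<S}" for t
      unfolding eq[OF that] by (rule lim[OF that])
    ultimately show ?thesis by blast
  qed
  have "C1_holder ?T \<delta> u"
    unfolding C1_holder_def
  proof (intro conjI exI[of _ u'] ballI)
    show "C0_holder ?T \<delta> u"
      by (rule C0T) (use sol in \<open>auto simp: holder_solution_def C1_holder_def\<close>)
    show "C0_holder ?T \<delta> u'" by (rule C0T) (use u' in auto)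
    fix t assume "t \<in> {0..<?T}"
    from ex[OF this] obtain S where S: "S \<in> A" "t \<in> {0..<S}" "at t within {0..<?T} = at t within {0..<S}" by auto
    show "((\<lambda>\<tau>. holder_norm \<delta> (\<lambda>x. (u \<tau> x - u t x) / (\<tau> - t) - u' t x)) \<longlongrightarrow> 0) (at t within {0..<?T})"
      using u'[OF S(1)] S(2) unfolding S(3) by blast
  qed
  moreover have "C0_holder ?T s u"
    by (rule C0T) (use sol in \<open>auto simp: holder_solution_def\<close>)
  moreover have "solves \<alpha> ?T u\<^sub>0 u"
    unfolding solves_def
  proof (intro conjI ballI)
    show "u 0 = u\<^sub>0" using ne sol by (auto simp: holder_solution_def solves_def)
    fix t assume "t \<in> {0..<?T}"
    from ex[OF this] obtain S where S: "S \<in> A" "t \<in> {0..<S}" "at t within {0..<?T} = at t within {0..<S}" by auto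
    have "solves \<alpha> S u\<^sub>0 u" using sol[OF S(1)] by (simp add: holder_solution_def)
    then show "\<forall>x. \<exists>u_t flux_x. ((\<lambda>\<tau>. u \<tau> x) has_real_derivative u_t) (at t within {0..<?T}) \<and>
        ((\<lambda>y. u t y * LambdaH \<alpha> (u t) y) has_real_derivative flux_x) (at x) \<and> u_t + flux_x = 0"
      using S(2) unfolding S(3) solves_def by blast
  qed
  ultimately show ?thesis by (simp add: holder_solution_def)
qed

text \<open>\<open>u\<close> is total in time, so its values after \<open>T\<^sub>0\<close> are
  those of the continued solution; \<open>continued\<close> is the continuation criterion, extending
  it past S unless the norm diverges there. \<open>u0_nontrivial\<close> excludes the zero datum,
  whose solution 0 is global.\<close>

theorem theorem1p1:
  fixes \<alpha> \<beta> \<epsilon> \<delta> T\<^sub>0 :: real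
    and u\<^sub>0 :: "real \<Rightarrow> real"
    and u :: "real \<Rightarrow> real \<Rightarrow> real"
  assumes alpha: "1 < \<alpha>" "\<alpha> < 2"
    and beta: "\<beta> = \<alpha> - 1"
    and eps: "0 < \<epsilon>" "\<alpha> + \<epsilon> < 2"
    and delta: "0 < \<delta>" "\<delta> < 1"
    and u0_reg: "u\<^sub>0 \<in> holder_space (\<alpha> + \<epsilon>)"
    and u0_nontrivial: "\<exists>x. u\<^sub>0 x \<noteq> 0"
    and H1: "compact (closure {x. u\<^sub>0 x \<noteq> 0})" "\<And>x. 0 \<le> u\<^sub>0 x"
    and H2: "u\<^sub>0 0 = 0" "deriv u\<^sub>0 0 = 0"
    and H3: "\<And>x. u\<^sub>0 x = u\<^sub>0 (- x)"
    and solution: "0 < T\<^sub>0" "holder_solution \<alpha> (1 + \<beta> + \<epsilon>) \<delta> T\<^sub>0 u\<^sub>0 u"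
    and continued: "\<And>S. 0 < S \<Longrightarrow> holder_solution \<alpha> (1 + \<beta> + \<epsilon>) \<delta> S u\<^sub>0 u \<Longrightarrow>
          \<not> filterlim (\<lambda>t. holder_norm (\<alpha> + \<epsilon>) (u t)) at_top (at_left S) \<Longrightarrow>
          \<exists>S'>S. holder_solution \<alpha> (1 + \<beta> + \<epsilon>) \<delta> S' u\<^sub>0 u"
  shows "\<exists>T>0. holder_solution \<alpha> (1 + \<beta> + \<epsilon>) \<delta> T u\<^sub>0 u \<and>
           filterlim (\<lambda>t. holder_norm (\<alpha> + \<epsilon>) (u t)) at_top (at_left T)"
proof -
  have s: "\<alpha> < 1 + \<beta> + \<epsilon>" "1 + \<beta> + \<epsilon> < 2" using beta eps by auto
  \<comment> \<open>The blow-up time is Sup A: it belongs to A, so a continuation beyond it would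
    contradict its being an upper bound.\<close>
  define A where "A = {S. 0 < S \<and> holder_solution \<alpha> (1 + \<beta> + \<epsilon>) \<delta> S u\<^sub>0 u}"
  have T0: "T\<^sub>0 \<in> A" using solution by (simp add: A_def)
  obtain x0 where x0: "u\<^sub>0 x0 \<noteq> 0" using u0_nontrivial by blast
  obtain Tmax where "\<And>S. 0 < S \<Longrightarrow> holder_solution \<alpha> (1 + \<beta> + \<epsilon>) \<delta> S u\<^sub>0 u \<Longrightarrow> S \<le> Tmax"
    by (rule existence_time_bounded[OF alpha s delta H1(2) x0 H2(1)]) blast
  then have bdd: "bdd_above A" by (auto simp: A_def intro!: bdd_aboveI)
  have sol: "holder_solution \<alpha> (1 + \<beta> + \<epsilon>) \<delta> (Sup A) u\<^sub>0 u"
    by (rule holder_solution_Sup[OF _ bdd delta]) (use T0 in \<open>auto simp: A_def\<close>)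
  have pos: "0 < Sup A" using cSup_upper[OF T0 bdd] solution(1) by simp
  have "filterlim (\<lambda>t. holder_norm (\<alpha> + \<epsilon>) (u t)) at_top (at_left (Sup A))"
  proof (rule ccontr)
    assume "\<not> ?thesis"
    then obtain S' where S': "S' > Sup A" "holder_solution \<alpha> (1 + \<beta> + \<epsilon>) \<delta> S' u\<^sub>0 u"
      using continued[OF pos sol] by blast
    then have "S' \<in> A" using pos by (simp add: A_def)
    then show False using cSup_upper[OF _ bdd] S'(1) by fastforce
  qed
  then show ?thesis using pos sol by blast
qed

end
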